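(* Let $f=a+b$ on $W=\mathbb{R}^p$, where $a:\mathbb{R}^p\to\mathbb{R}$ is $\alpha$-strongly convex ($\alpha>0$) and $L$-smooth, and $b:\mathbb{R}^p\to\mathbb{R}$ is continuous and convex. Let $w^*$ be the minimizer of $f$. Let $\beta,\epsilon\in(0,1)$, $v_0\in W$, backtracking parameter $\eta\in(1,\infty)$, and initial smoothness estimate $\ell_0^0\in(0,L]$. Define $$\bar\kappa:=\frac{L\eta}{\alpha},\qquad \rho:=\frac{1+\beta}{\beta},\qquad t^*:=1+\sqrt{\bar\kappa}\left(\rho+\sqrt{\rho^2+4\rho}\right).$$ Let $\{v_i\}_{i\ge0}$, $\{\tau_i\}_{i\ge1}$ be generated by adaptively restarted AGD (defined in the context) from $v_0$ with parameter $\beta$ and arbitrary initial epoch length $\tau_1\in\mathbb{N}$. Then for $$n=\left\lceil\log_{1/\beta}(2/\epsilon)+3\log_{1/\beta}\big(\max\{1,t^*/\tau_1\}\big)\right\rceil$$ one has $\|w^*-v_n\|_2\le\epsilon\,\|w^*-v_0\|_2$ and $\sum_{i=1}^n\tau_i\le t^*n+2(\tau_1-t^* )^+$.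
   Context: $\mathbb{N}=\{1,2,\dots\}$; $(c)^+=\max\{c,0\}$. A function $a$ is $\alpha$-strongly convex if $\lambda_{\min}(\nabla^2a(x))\ge\alpha$ for all $x$, and $L$-smooth if it is differentiable with $\|\nabla a(w)-\nabla a(w')\|_2\le L\|w-w'\|_2$ for all $w,w'$. For $\ell>0$ let $p_\ell(y)=\arg\min_{x\in\mathbb{R}^p}\nabla a(y)^T(x-y)+b(x)+\frac\ell2\|x-y\|_2^2$. AGD (FISTA with backtracking) from $v\in\mathbb{R}^p$: set $w^0=z^0=v$, $\lambda^0=1$, $\ell^0=\ell_0^0$. For $t=1,2,\dots$: let $k$ be the smallest nonnegative integer such that with $\bar\ell=\eta^k\ell^{t-1}$ and $p=p_{\bar\ell}(z^{t-1})$, $$f(p)\le a(z^{t-1})+(p-z^{t-1})^T\nabla a(z^{t-1})+\tfrac{\bar\ell}{2}\|p-z^{t-1}\|_2^2+b(p);$$ set $\ell^t=\eta^k\ell^{t-1}$, $w^t=p_{\ell^t}(z^{t-1})$, $\lambda^t=\frac{1+\sqrt{1+4(\lambda^{t-1})^2}}{2}$, $z^t=w^t+\frac{\lambda^{t-1}-1}{\lambda^t}(w^t-w^{t-1})$. The output at step $t$ is $w^t=w^t(v)$. Adaptively restarted AGD with parameter $\beta$: given $v_0$, for epochs $i=1,2,\dots$ run AGD from $v_{i-1}$, producing $w_i^t=w^t(v_{i-1})$. Epoch $1$ is stopped after an arbitrarily chosen number $\tau_1\in\mathbb{N}$ of steps. For $i>1$, epoch $i$ is stopped at the first $t\in\mathbb{N}$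 (called $\tau_i$) with $$\frac{\|w_i^t-v_{i-1}\|_2}{(t+1)^2}\le\beta\,\frac{\|v_{i-1}-v_{i-2}\|_2}{(\tau_{i-1}+1)^2}.$$ Set $v_i=w_i^{\tau_i}$. *)

theory Defs
  imports "HOL-Analysis.Analysis"
begin

definition gradient :: "(real ^ 'n \<Rightarrow> real) \<Rightarrow> real ^ 'n \<Rightarrow> real ^ 'n"
  where "gradient a x = (THE D. GDERIV a x :> D)"

definition hessian :: "(real ^ 'n \<Rightarrow> real) \<Rightarrow> real ^ 'n \<Rightarrow> real ^ 'n ^ 'n"
  where "hessian a x = jacobian (gradient a) (at x)"

definition eigenvalues :: "real ^ 'n ^ 'n \<Rightarrow> real set"
  where "eigenvalues A = {c. \<exists>v. v \<noteq> 0 \<and> A *v v = c *\<^sub>R v}"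

text \<open>Only used for Hessians, which are symmetric, so that all complex eigenvalues are real
  and the set is finite and nonempty.\<close>

definition lambda_min :: "real ^ 'n ^ 'n \<Rightarrow> real"
  where "lambda_min A = Min (eigenvalues A)"

text \<open>The Hessian is required to exist everywhere, but not to be continuous.\<close>

definition strongly_convex :: "real \<Rightarrow> (real ^ 'n \<Rightarrow> real) \<Rightarrow> bool"
  where "strongly_convex \<alpha> a \<longleftrightarrow>
    (\<forall>x. a differentiable (at x) \<and> gradient a differentiable (at x) \<and>
         lambda_min (hessian a x) \<ge> \<alpha>)"

definition L_smooth :: "real \<Rightarrow> (real ^ 'n \<Rightarrow> real) \<Rightarrow> bool"
  where "L_smooth L a \<longleftrightarrow>
    (\<forall>x. a differentiable (at x)) \<and>
    (\<forall>w w'. norm (gradient a w - gradient a w') \<le> L * norm (w - w'))"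

definition prox_step ::
  "(real ^ 'n \<Rightarrow> real) \<Rightarrow> (real ^ 'n \<Rightarrow> real) \<Rightarrow> real \<Rightarrow> real ^ 'n \<Rightarrow> real ^ 'n"
  where "prox_step a b l y =
    (arg_min (\<lambda>x. gradient a y \<bullet> (x - y) + b x + l / 2 * (norm (x - y))\<^sup>2) (\<lambda>_. True))"

definition sufficient_decrease ::
  "(real ^ 'n \<Rightarrow> real) \<Rightarrow> (real ^ 'n \<Rightarrow> real) \<Rightarrow> real \<Rightarrow> real ^ 'n \<Rightarrow> bool"
  where "sufficient_decrease a b l z \<longleftrightarrow>
    (let p = prox_step a b l z in
      a p + b p \<le> a z + (p - z) \<bullet> gradient a z + l / 2 * (norm (p - z))\<^sup>2 + b p)"

definition backtrack ::
  "(real ^ 'n \<Rightarrow> real) \<Rightarrow> (real ^ 'n \<Rightarrow> real) \<Rightarrow> real \<Rightarrow> real \<Rightarrow> real ^ 'n \<Rightarrow> real"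
  where "backtrack a b \<eta> l z = \<eta> ^ (LEAST k. sufficient_decrease a b (\<eta> ^ k * l) z) * l"

text \<open>The state after \<open>t\<close> steps is \<open>(w\<^sup>t, z\<^sup>t, \<lambda>\<^sup>t, \<ell>\<^sup>t)\<close>; \<open>l0\<close> is the initial smoothness estimate.\<close>

primrec agd_state ::
  "(real ^ 'n \<Rightarrow> real) \<Rightarrow> (real ^ 'n \<Rightarrow> real) \<Rightarrow> real \<Rightarrow> real \<Rightarrow> real ^ 'n \<Rightarrow> nat \<Rightarrow>
    (real ^ 'n) \<times> (real ^ 'n) \<times> real \<times> real"
  where
    "agd_state a b \<eta> l0 v 0 = (v, v, 1, l0)"
  | "agd_state a b \<eta> l0 v (Suc t) =
      (let (w, z, lam, l) = agd_state a b \<eta> l0 v t;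
           l' = backtrack a b \<eta> l z;
           w' = prox_step a b l' z;
           lam' = (1 + sqrt (1 + 4 * lam\<^sup>2)) / 2;
           z' = w' + ((lam - 1) / lam') *\<^sub>R (w' - w)
       in (w', z', lam', l'))"

definition agd ::
  "(real ^ 'n \<Rightarrow> real) \<Rightarrow> (real ^ 'n \<Rightarrow> real) \<Rightarrow> real \<Rightarrow> real \<Rightarrow> real ^ 'n \<Rightarrow> nat \<Rightarrow> real ^ 'n"
  where "agd a b \<eta> l0 v t = fst (agd_state a b \<eta> l0 v t)"

text \<open>The sequence \<open>v\<close> is indexed from 0 and the epoch lengths \<open>\<tau>\<close> from 1; the value \<open>\<tau> 0\<close> is
  irrelevant. Since stopping times are given by \<open>LEAST\<close>, the predicate does not presuppose that
  the stopping condition is ever met: for every first epoch length there are such sequences,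
  and their values at positive indices (and \<open>v 0\<close>) are uniquely determined.\<close>

definition adaptively_restarted_agd ::
  "(real ^ 'n \<Rightarrow> real) \<Rightarrow> (real ^ 'n \<Rightarrow> real) \<Rightarrow> real \<Rightarrow> real \<Rightarrow> real \<Rightarrow> real ^ 'n \<Rightarrow>
    (nat \<Rightarrow> real ^ 'n) \<Rightarrow> (nat \<Rightarrow> nat) \<Rightarrow> bool"
  where "adaptively_restarted_agd a b \<eta> l0 \<beta> v0 v \<tau> \<longleftrightarrow>
    v 0 = v0 \<and>
    1 \<le> \<tau> 1 \<and>
    (\<forall>i>1. \<tau> i = (LEAST t. 1 \<le> t \<and>
        norm (agd a b \<eta> l0 (v (i - 1)) t - v (i - 1)) / (real t + 1)\<^sup>2
        \<le> \<beta> * (norm (v (i - 1) - v (i - 2)) / (real (\<tau> (i - 1)) + 1)\<^sup>2))) \<and>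
    (\<forall>i\<ge>1. v i = agd a b \<eta> l0 (v (i - 1)) (\<tau> i))"

end

theory Submission
  imports Defs
begin

text \<open>Let \<open>D\<close> be the distance from the starting point \<open>v\<close> of an epoch to the minimiser,
  \<open>D\<^sub>t\<close> the distance from \<open>w\<^sup>t\<close> to the minimiser, \<open>d\<^sub>t\<close> the distance from \<open>v\<close> to \<open>w\<^sup>t\<close>,
  and \<open>r = (t + 1) / (2 \<surd>\<kappa>)\<close>. The FISTA potential gives the classical bound
  \<open>r D\<^sub>t \<le> D\<close>, which is void for short epochs. As \<open>w\<^sup>t\<close> is an average of auxiliary points whose
  distances to the minimiser are controlled by the potential, one also gets
  \<open>(1 + r\<^sup>2 / 2) D\<^sub>t\<^sup>2 \<le> D\<^sup>2\<close>. With the triangle inequality these two bounds show that, for a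
  constant \<open>K r\<close>, \<open>r\<^sup>2 D\<^sub>t \<le> K r d\<^sub>t\<close> for epochs of every length, also with backtracking.

  Hence an observed displacement bounds the distance to the minimiser and therewith all later
  displacements, so that the stopping test of an epoch is passed at some \<open>t \<le> t\<^sup>*\<close> or at some
  \<open>t\<close> at most halfway between \<open>t\<^sup>*\<close> and the previous length; this bounds the total length.
  Chaining the tests bounds the last displacement by \<open>\<beta>\<^sup>n\<^sup>-\<^sup>1\<close> times the first one (after scaling
  by \<open>(\<tau>\<^sub>i + 1)\<^sup>2\<close>), and applying the displacement bound once more to the last epoch gives the
  convergence claim.\<close>

section \<open>Strong convexity from the Hessian\<close>

text \<open>Riesz: a derivative \<open>f'\<close> is represented by the vector
  \<open>adjoint f' 1\<close>, and only by it, so the \<open>THE\<close> in \<open>gradient\<close>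
  denotes this vector.\<close>

lemma has_derivative_gradient:
  fixes a :: "real ^ 'n \<Rightarrow> real"
  assumes "a differentiable (at x)"
  shows "(a has_derivative (\<lambda>h. gradient a x \<bullet> h)) (at x)"
proof -
  obtain f' where f': "(a has_derivative f') (at x)"
    using assms by (auto simp: differentiable_def)
  then have "linear f'" by (simp add: has_derivative_linear)
  then have "f' = (\<lambda>h. h \<bullet> adjoint f' 1)"
    using adjoint_works[of f'] by (metis inner_real_def mult.right_neutral)
  with f' have "GDERIV a x :> adjoint f' 1" by (simp add: gderiv_def)
  moreover have "D = D'" if "GDERIV a x :> D" "GDERIV a x :> D'" for D D'
    using that unfolding gderiv_def
    by (metis has_derivative_unique inner_commute vector_eq_ldot)
  ultimately have "GDERIV a x :> gradient a x"
    unfolding gradient_def by (metis theI)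
  then show ?thesis by (simp add: gderiv_def inner_commute)
qed

section \<open>Derivatives along lines and symmetry of the Hessian\<close>

lemma has_field_derivative_along_line:
  fixes f :: "'a::real_inner \<Rightarrow> real"
  assumes "\<And>y. (f has_derivative (\<lambda>h. g y \<bullet> h)) (at y)"
  shows "((\<lambda>s. f (p + s *\<^sub>R u)) has_real_derivative g (p + s *\<^sub>R u) \<bullet> u) (at s)"
proof -
  have "((\<lambda>s. p + s *\<^sub>R u) has_derivative (\<lambda>s. s *\<^sub>R u)) (at s)"
    by (auto intro!: derivative_eq_intros)
  from has_derivative_compose[OF this assms]
  have "((\<lambda>s. f (p + s *\<^sub>R u)) has_derivative (\<lambda>h. g (p + s *\<^sub>R u) \<bullet> (h *\<^sub>R u))) (at s)" .
  then show ?thesis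
    by (simp add: has_field_derivative_def mult.commute[of _ "_ \<bullet> _"])
qed

text \<open>The mean value theorem in direction \<open>u\<close>, applied to the increment of
  \<open>f\<close> in direction \<open>v\<close>, leaves two values of \<open>g\<close> near
  \<open>x\<close>; both are linearised at \<open>x\<close>.\<close>

lemma second_difference_bound:
  fixes f :: "'a::real_inner \<Rightarrow> real"
  assumes f: "\<And>y. (f has_derivative (\<lambda>h. g y \<bullet> h)) (at y)"
    and G: "linear G" "\<And>h. norm h < \<delta> \<Longrightarrow> norm (g (x + h) - g x - G h) \<le> e * norm h"
    and "norm u + norm v < \<delta>" "e > 0"
  shows "\<bar>(f (x + u + v) - f (x + u) - f (x + v) + f x) - G v \<bullet> u\<bar>
    \<le> 2 * e * (norm u + norm v)\<^sup>2"
proof -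
  define \<phi> where "\<phi> s = f ((x + v) + s *\<^sub>R u) - f (x + s *\<^sub>R u)" for s :: real
  have "(\<phi> has_real_derivative (g ((x + v) + s *\<^sub>R u) - g (x + s *\<^sub>R u)) \<bullet> u) (at s)" for s
    unfolding \<phi>_def inner_diff_left
    by (intro DERIV_diff has_field_derivative_along_line f)
  then obtain s where s: "0 < s" "s < 1"
    "\<phi> 1 - \<phi> 0 = (g ((x + v) + s *\<^sub>R u) - g (x + s *\<^sub>R u)) \<bullet> u"
    using MVT2[of 0 1 \<phi> "\<lambda>s. (g ((x + v) + s *\<^sub>R u) - g (x + s *\<^sub>R u)) \<bullet> u"] by auto
  define m where "m = norm u + norm v"
  have su: "norm (s *\<^sub>R u) \<le> norm u" using s by (simp add: mult_left_le_one_le)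
  have m1: "norm (v + s *\<^sub>R u) \<le> m" "norm (s *\<^sub>R u) \<le> m"
    using su norm_triangle_ineq[of v "s *\<^sub>R u"] by (auto simp: m_def intro: order_trans)
  have r1: "norm (g (x + (v + s *\<^sub>R u)) - g x - G (v + s *\<^sub>R u)) \<le> e * m"
    by (rule order_trans[OF G(2)]) (use m1 assms m_def in auto)
  have r2: "norm (g (x + s *\<^sub>R u) - g x - G (s *\<^sub>R u)) \<le> e * m"
    by (rule order_trans[OF G(2)]) (use m1 assms m_def in auto)
  define E where "E = (g (x + (v + s *\<^sub>R u)) - g x - G (v + s *\<^sub>R u))
    - (g (x + s *\<^sub>R u) - g x - G (s *\<^sub>R u))"
  have E: "norm E \<le> 2 * e * m"
    using r1 r2 norm_triangle_ineq4[of "g (x + (v + s *\<^sub>R u)) - g x - G (v + s *\<^sub>R u)"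
        "g (x + s *\<^sub>R u) - g x - G (s *\<^sub>R u)"] by (simp add: E_def)
  have "\<phi> 1 - \<phi> 0 - G v \<bullet> u = E \<bullet> u"
    unfolding s E_def by (simp add: linear_add[OF G(1)] algebra_simps)
  also have "\<bar>\<dots>\<bar> \<le> norm E * norm u" by (rule Cauchy_Schwarz_ineq2)
  also have "\<dots> \<le> (2 * e * m) * m" using E by (intro mult_mono) (auto simp: m_def \<open>e > 0\<close> less_imp_le)
  finally show ?thesis by (simp add: \<phi>_def m_def power2_eq_square algebra_simps)
qed

text \<open>The second difference is unchanged when \<open>u\<close> and \<open>v\<close> are
  swapped and, after scaling, approximates both sides up to a multiple of \<open>e\<close>, which is
  arbitrary.\<close>

lemma symmetric_second_derivative:
  fixes f :: "'a::real_inner \<Rightarrow> real"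
  assumes f: "\<And>y. (f has_derivative (\<lambda>h. g y \<bullet> h)) (at y)"
    and G: "(g has_derivative G) (at x)"
  shows "G u \<bullet> v = G v \<bullet> u"
proof -
  define m where "m = norm u + norm v"
  have lin: "linear G" using G by (rule has_derivative_linear)
  have "\<bar>G u \<bullet> v - G v \<bullet> u\<bar> \<le> 4 * m\<^sup>2 * e" if e: "e > 0" for e
  proof -
    obtain \<delta> where \<delta>: "\<delta> > 0" "\<And>y. norm (y - x) < \<delta> \<Longrightarrow> norm (g y - g x - G (y - x)) \<le> e * norm (y - x)"
      using G e unfolding has_derivative_at_alt by blast
    define t where "t = \<delta> / (m + 1) / 2"
    have m0: "m \<ge> 0" by (simp add: m_def)
    then have t: "t > 0" using \<delta> by (simp add: t_def)
    have "t * m < \<delta>"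
    proof -
      have "t * m = \<delta> * (m / (m + 1) / 2)" by (simp add: t_def)
      also have "\<dots> < \<delta> * 1" using \<delta> m0 by (intro mult_strict_left_mono) (auto simp: field_simps)
      finally show ?thesis by simp
    qed
    then have small: "norm (t *\<^sub>R u) + norm (t *\<^sub>R v) < \<delta>"
      using t by (simp add: m_def distrib_left)
    have \<delta>': "norm (g (x + h) - g x - G h) \<le> e * norm h" if "norm h < \<delta>" for h
      using \<delta>(2)[of "x + h"] that by simp
    have nm: "(norm (t *\<^sub>R u) + norm (t *\<^sub>R v))\<^sup>2 = t\<^sup>2 * m\<^sup>2"
      using t by (simp add: m_def algebra_simps power2_eq_square)
    define \<Delta> where "\<Delta> = f (x + t *\<^sub>R u + t *\<^sub>R v) - f (x + t *\<^sub>R u) - f (x + t *\<^sub>R v) + f x"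
    have "\<bar>\<Delta> - t\<^sup>2 * (G v \<bullet> u)\<bar> \<le> 2 * e * (t\<^sup>2 * m\<^sup>2)"
      using second_difference_bound[OF f lin \<delta>' small e] nm
      by (simp add: \<Delta>_def linear_scale[OF lin] power2_eq_square mult.assoc)
    moreover have "\<bar>\<Delta> - t\<^sup>2 * (G u \<bullet> v)\<bar> \<le> 2 * e * (t\<^sup>2 * m\<^sup>2)"
    proof -
      have "norm (t *\<^sub>R v) + norm (t *\<^sub>R u) < \<delta>" using small by (simp only: add.commute)
      note second_difference_bound[OF f lin \<delta>' this e]
      moreover have "f (x + t *\<^sub>R v + t *\<^sub>R u) - f (x + t *\<^sub>R v) - f (x + t *\<^sub>R u) + f x = \<Delta>"
        by (simp add: \<Delta>_def add.assoc add.commute[of "t *\<^sub>R v"])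
      moreover have "G (t *\<^sub>R u) \<bullet> (t *\<^sub>R v) = t\<^sup>2 * (G u \<bullet> v)"
        by (simp add: linear_scale[OF lin] power2_eq_square)
      moreover have "(norm (t *\<^sub>R v) + norm (t *\<^sub>R u))\<^sup>2 = t\<^sup>2 * m\<^sup>2"
        using nm by (simp only: add.commute)
      ultimately show ?thesis by metis
    qed
    ultimately have "\<bar>t\<^sup>2 * (G u \<bullet> v) - t\<^sup>2 * (G v \<bullet> u)\<bar> \<le> 4 * e * (t\<^sup>2 * m\<^sup>2)" by linarith
    moreover have "\<bar>t\<^sup>2 * (G u \<bullet> v) - t\<^sup>2 * (G v \<bullet> u)\<bar> = t\<^sup>2 * \<bar>G u \<bullet> v - G v \<bullet> u\<bar>"
      by (simp add: abs_mult flip: right_diff_distrib)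
    ultimately have "t\<^sup>2 * \<bar>G u \<bullet> v - G v \<bullet> u\<bar> \<le> t\<^sup>2 * (4 * m\<^sup>2 * e)"
      by (simp add: mult_ac)
    then show ?thesis using t by (simp add: mult_le_cancel_left)
  qed
  note * = this
  show ?thesis
  proof (rule ccontr)
    assume "G u \<bullet> v \<noteq> G v \<bullet> u"
    define d where "d = \<bar>G u \<bullet> v - G v \<bullet> u\<bar>"
    have d: "d > 0" using \<open>G u \<bullet> v \<noteq> G v \<bullet> u\<close> by (simp add: d_def)
    have "d \<le> 4 * m\<^sup>2 * (d / (8 * m\<^sup>2 + 1))"
      unfolding d_def by (rule *) (use d d_def in \<open>auto intro!: divide_pos_pos add_nonneg_pos\<close>)
    also have "\<dots> = d * (4 * m\<^sup>2 / (8 * m\<^sup>2 + 1))" by simp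
    also have "\<dots> < d * 1" using d
      by (intro mult_strict_left_mono) (auto simp: divide_less_eq add_nonneg_pos intro: add_pos_nonneg)
    finally show False by simp
  qed
qed

text \<open>Eigenvectors of distinct eigenvalues are orthogonal, hence independent. Finiteness makes
  the \<open>Min\<close> in \<open>lambda_min\<close> a lower bound of the spectrum.\<close>

lemma finite_eigenvalues_symmetric:
  fixes A :: "real ^ 'n ^ 'n"
  assumes sym: "\<And>u v. (A *v u) \<bullet> v = (A *v v) \<bullet> u"
  shows "finite (eigenvalues A)"
proof -
  have "\<forall>c \<in> eigenvalues A. \<exists>v. v \<noteq> 0 \<and> A *v v = c *\<^sub>R v" by (auto simp: eigenvalues_def)
  then obtain V where V: "\<And>c. c \<in> eigenvalues A \<Longrightarrow> V c \<noteq> 0 \<and> A *v (V c) = c *\<^sub>R V c" by metis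
  have orth: "V c \<bullet> V d = 0" if "c \<in> eigenvalues A" "d \<in> eigenvalues A" "c \<noteq> d" for c d
  proof -
    have "c * (V c \<bullet> V d) = d * (V c \<bullet> V d)"
      using sym[of "V c" "V d"] V[OF that(1)] V[OF that(2)] by (simp add: inner_commute)
    with that show ?thesis by simp
  qed
  have inj: "inj_on V (eigenvalues A)"
    by (rule inj_onI) (metis V orth inner_eq_zero_iff)
  have "independent (V ` eigenvalues A)"
  proof (rule pairwise_orthogonal_independent)
    show "pairwise orthogonal (V ` eigenvalues A)"
      unfolding pairwise_def orthogonal_def by (auto intro!: orth)
    show "0 \<notin> V ` eigenvalues A" using V by fastforce
  qed
  then have "finite (V ` eigenvalues A)" using independent_bound by blast
  then show ?thesis using inj by (rule finite_imageD)
qed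

text \<open>A minimiser of the Rayleigh quotient on the unit sphere is an eigenvector.\<close>

lemma lambda_min_le_quadratic_form:
  fixes A :: "real ^ 'n ^ 'n"
  assumes sym: "\<And>u v. (A *v u) \<bullet> v = (A *v v) \<bullet> u"
  shows "lambda_min A * (norm x)\<^sup>2 \<le> (A *v x) \<bullet> x"
proof -
  have "compact (sphere (0 :: real ^ 'n) 1)" by simp
  moreover have "(sphere (0 :: real ^ 'n) 1) \<noteq> {}" by simp
  moreover have "continuous_on (sphere 0 1) (\<lambda>u. (A *v u) \<bullet> u)"
    by (intro continuous_intros matrix_vector_mult_linear_continuous_on)
  ultimately obtain u where u: "norm u = 1" "\<And>y. norm y = 1 \<Longrightarrow> (A *v u) \<bullet> u \<le> (A *v y) \<bullet> y"
    using continuous_attains_inf[of "sphere 0 1" "\<lambda>u. (A *v u) \<bullet> u"] by auto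
  define m where "m = (A *v u) \<bullet> u"
  have m: "m * (norm y)\<^sup>2 \<le> (A *v y) \<bullet> y" for y
  proof (cases "y = 0")
    case False
    have "m \<le> (A *v (y /\<^sub>R norm y)) \<bullet> (y /\<^sub>R norm y)"
      unfolding m_def by (rule u) (simp add: False)
    also have "\<dots> = ((A *v y) \<bullet> y) / (norm y)\<^sup>2"
      by (simp add: matrix_vector_mult_scaleR power2_eq_square divide_inverse)
    finally show ?thesis using False by (simp add: field_simps)
  qed simp
  define B where "B y = A *v y - m *\<^sub>R y" for y
  have Bnn: "0 \<le> B y \<bullet> y" for y
    using m[of y] by (simp add: B_def inner_diff_left power2_norm_eq_inner)
  have Bu: "B u \<bullet> u = 0" using u by (simp add: B_def inner_diff_left m_def flip: power2_norm_eq_inner)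
  have "B u = 0"
  proof (rule ccontr)
    assume ne: "B u \<noteq> 0"
    define w where "w = B u"
    \<comment> \<open>Moving from \<open>u\<close> by \<open>t *\<^sub>R w\<close> changes the
      nonnegative form of \<open>B\<close> from 0 by \<open>2 * t * (w \<bullet> w)\<close> plus a
      quadratic term; this negative \<open>t\<close> keeps the latter at most half as large.\<close>
    define t where "t = - (w \<bullet> w) / (1 + \<bar>B w \<bullet> w\<bar>)"
    have ww: "w \<bullet> w > 0" using ne by (simp add: w_def)
    have "B (u + t *\<^sub>R w) = B u + t *\<^sub>R B w"
      by (simp add: B_def matrix_vector_right_distrib matrix_vector_mult_scaleR algebra_simps)
    then have "0 \<le> (B u + t *\<^sub>R B w) \<bullet> (u + t *\<^sub>R w)" using Bnn[of "u + t *\<^sub>R w"] by simp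
    also have "\<dots> = B u \<bullet> u + t * (B u \<bullet> w) + t * (B w \<bullet> u) + t * t * (B w \<bullet> w)"
      by (simp add: algebra_simps)
    also have "B w \<bullet> u = B u \<bullet> w"
      using sym[of w u] by (simp add: B_def algebra_simps inner_commute)
    also have "B u \<bullet> w = w \<bullet> w" by (simp add: w_def)
    finally have "0 \<le> 2 * t * (w \<bullet> w) + t * t * (B w \<bullet> w)" using Bu by simp
    also have "\<dots> \<le> 2 * t * (w \<bullet> w) + t * t * (1 + \<bar>B w \<bullet> w\<bar>)"
      by (intro add_left_mono mult_left_mono) auto
    also have "t * (1 + \<bar>B w \<bullet> w\<bar>) = - (w \<bullet> w)"
    proof -
      have "1 + \<bar>B w \<bullet> w\<bar> \<noteq> 0" by linarith
      then show ?thesis by (simp add: t_def)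
    qed
    then have "2 * t * (w \<bullet> w) + t * t * (1 + \<bar>B w \<bullet> w\<bar>) = t * (w \<bullet> w)"
      by (simp add: mult.assoc)
    finally have "0 \<le> t * (w \<bullet> w)" .
    moreover have "t < 0" using ww by (simp add: t_def add_pos_nonneg)
    ultimately show False using ww by (simp add: zero_le_mult_iff)
  qed
  then have "m \<in> eigenvalues A"
    using u(1) unfolding eigenvalues_def B_def by (auto intro!: exI[of _ u])
  then have "lambda_min A \<le> m"
    unfolding lambda_min_def by (intro Min_le finite_eigenvalues_symmetric sym)
  then have "lambda_min A * (norm x)\<^sup>2 \<le> m * (norm x)\<^sup>2" by (intro mult_right_mono) auto
  also have "\<dots> \<le> (A *v x) \<bullet> x" by (rule m)
  finally show ?thesis .
qed

text \<open>Two monotonicity arguments along the segment: \<open>\<psi>\<close> is nondecreasing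
  because the quadratic form of the symmetric Hessian is at least \<alpha> times the squared norm,
  and \<open>\<theta>\<close> because its derivative is \<open>\<psi> s - \<psi> 0\<close>.\<close>

lemma strongly_convex_quadratic_lower_bound:
  fixes a :: "real ^ 'n \<Rightarrow> real"
  assumes "strongly_convex \<alpha> a"
  shows "a x + gradient a x \<bullet> h + \<alpha> / 2 * (norm h)\<^sup>2 \<le> a (x + h)"
proof -
  have da: "(a has_derivative (\<lambda>h. gradient a y \<bullet> h)) (at y)" for y
    using assms by (auto simp: strongly_convex_def intro: has_derivative_gradient)
  have dg: "(gradient a has_derivative (\<lambda>h. hessian a y *v h)) (at y)" for y
    using assms by (simp add: strongly_convex_def hessian_def jacobian_works[symmetric])
  have hess: "\<alpha> * (norm h)\<^sup>2 \<le> (hessian a y *v h) \<bullet> h" for y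
  proof -
    have "\<alpha> * (norm h)\<^sup>2 \<le> lambda_min (hessian a y) * (norm h)\<^sup>2"
      using assms by (intro mult_right_mono) (auto simp: strongly_convex_def)
    also have "\<dots> \<le> (hessian a y *v h) \<bullet> h"
      by (rule lambda_min_le_quadratic_form, rule symmetric_second_derivative[OF da dg])
    finally show ?thesis .
  qed
  define \<psi> where "\<psi> s = gradient a (x + s *\<^sub>R h) \<bullet> h - \<alpha> * s * (norm h)\<^sup>2" for s
  have d\<psi>: "(\<psi> has_real_derivative (hessian a (x + s *\<^sub>R h) *v h) \<bullet> h - \<alpha> * (norm h)\<^sup>2) (at s)" for s
  proof -
    have "((\<lambda>s. x + s *\<^sub>R h) has_derivative (\<lambda>s. s *\<^sub>R h)) (at s)"
      by (auto intro!: derivative_eq_intros)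
    from has_derivative_compose[OF this dg]
    have "((\<lambda>s. gradient a (x + s *\<^sub>R h)) has_derivative
        (\<lambda>k. hessian a (x + s *\<^sub>R h) *v (k *\<^sub>R h))) (at s)" .
    from has_derivative_inner_left[OF this, of h]
    have "((\<lambda>s. gradient a (x + s *\<^sub>R h) \<bullet> h) has_real_derivative
        (hessian a (x + s *\<^sub>R h) *v h) \<bullet> h) (at s)"
      unfolding has_field_derivative_def
      by (simp add: matrix_vector_mult_scaleR) (metis (no_types, lifting) ext mult.commute)
    then show ?thesis unfolding \<psi>_def by (auto intro!: derivative_eq_intros)
  qed
  have \<psi>: "\<psi> 0 \<le> \<psi> s" if "0 \<le> s" for s
    by (rule DERIV_nonneg_imp_nondecreasing[OF that]) (use d\<psi> hess in force)
  define \<theta> where "\<theta> s = a (x + s *\<^sub>R h) - s * \<psi> 0 - \<alpha> / 2 * s\<^sup>2 * (norm h)\<^sup>2" for s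
  have d\<theta>: "(\<theta> has_real_derivative \<psi> s - \<psi> 0) (at s)" for s
    unfolding \<theta>_def
    by (rule derivative_eq_intros has_field_derivative_along_line[OF da] refl)+
      (simp add: \<psi>_def algebra_simps)
  have "\<theta> 0 \<le> \<theta> 1"
    by (rule DERIV_nonneg_imp_nondecreasing) (use d\<theta> \<psi> in force)+
  then show ?thesis by (simp add: \<theta>_def \<psi>_def)
qed

text \<open>The descent lemma: by Cauchy-Schwarz and the Lipschitz bound the gap between the two
  sides is nondecreasing along the segment.\<close>

lemma L_smooth_quadratic_upper_bound:
  fixes a :: "real ^ 'n \<Rightarrow> real"
  assumes "L_smooth L a"
  shows "a (x + h) \<le> a x + gradient a x \<bullet> h + L / 2 * (norm h)\<^sup>2"
proof -
  have da: "(a has_derivative (\<lambda>h. gradient a y \<bullet> h)) (at y)" for y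
    using assms by (auto simp: L_smooth_def intro: has_derivative_gradient)
  define \<theta> where "\<theta> s = s * (gradient a x \<bullet> h) + L / 2 * s\<^sup>2 * (norm h)\<^sup>2 - a (x + s *\<^sub>R h)" for s
  have d\<theta>: "(\<theta> has_real_derivative
      gradient a x \<bullet> h + L * s * (norm h)\<^sup>2 - gradient a (x + s *\<^sub>R h) \<bullet> h) (at s)" for s
    unfolding \<theta>_def
    by (rule derivative_eq_intros has_field_derivative_along_line[OF da] refl)+ simp
  have nn: "0 \<le> gradient a x \<bullet> h + L * s * (norm h)\<^sup>2 - gradient a (x + s *\<^sub>R h) \<bullet> h" if "0 \<le> s" for s
  proof -
    have "(gradient a (x + s *\<^sub>R h) - gradient a x) \<bullet> h
        \<le> norm (gradient a (x + s *\<^sub>R h) - gradient a x) * norm h"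
      by (rule norm_cauchy_schwarz)
    also have "norm (gradient a (x + s *\<^sub>R h) - gradient a x) \<le> L * norm (s *\<^sub>R h)"
      using assms unfolding L_smooth_def by (metis add_diff_cancel_left')
    finally show ?thesis using that by (simp add: inner_diff_left power2_eq_square mult_right_mono)
  qed
  have "\<theta> 0 \<le> \<theta> 1"
    by (rule DERIV_nonneg_imp_nondecreasing) (use d\<theta> nn in force)+
  then show ?thesis by (simp add: \<theta>_def)
qed

text \<open>The two quadratic bounds are compared at a unit vector; the result yields
  \<open>kappa \<ge> 1\<close>.\<close>

lemma strong_convexity_le_smoothness:
  fixes a :: "real ^ 'n \<Rightarrow> real"
  assumes "strongly_convex \<alpha> a" "L_smooth L a"
  shows "\<alpha> \<le> L"
proof -
  obtain h :: "real ^ 'n" where "norm h = 1" using vector_choose_size[of 1] by auto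
  then show ?thesis
    using strongly_convex_quadratic_lower_bound[OF assms(1), of 0 h]
      L_smooth_quadratic_upper_bound[OF assms(2), of 0 h] by simp
qed

section \<open>Proximal gradient steps\<close>

lemma nonneg_if_affine_nonneg_near_0:
  fixes k c :: real
  assumes "\<And>s. 0 < s \<Longrightarrow> s \<le> 1 \<Longrightarrow> 0 \<le> k + s * c"
  shows "0 \<le> k"
proof -
  have "((\<lambda>s. k + s * c) \<longlongrightarrow> k + 0 * c) (at_right 0)" by (intro tendsto_intros)
  then have "((\<lambda>s. k + s * c) \<longlongrightarrow> k) (at_right 0)" by simp
  moreover have "\<forall>\<^sub>F s in at_right 0. 0 \<le> k + s * c"
    using assms by (auto simp: eventually_at_right_field intro!: exI[of _ 1])
  ultimately show ?thesis by (rule tendsto_lowerbound) simp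
qed

text \<open>First-order optimality: \<open>- (g + l *\<^sub>R (p - y))\<close> is a subgradient of
  \<open>b\<close> at \<open>p\<close>. Compare \<open>p\<close> with
  \<open>p + s *\<^sub>R h\<close>, divide by \<open>s\<close> and let \<open>s\<close> tend to
  0.\<close>

lemma convex_regularised_minimizer_variational:
  fixes b :: "'a::real_inner \<Rightarrow> real"
  assumes b: "convex_on UNIV b"
    and min: "\<And>x. g \<bullet> (p - y) + b p + l / 2 * (norm (p - y))\<^sup>2
      \<le> g \<bullet> (x - y) + b x + l / 2 * (norm (x - y))\<^sup>2"
  shows "b p - (g + l *\<^sub>R (p - y)) \<bullet> (x - p) \<le> b x"
proof -
  define h where "h = x - p"
  define k where "k = g \<bullet> h + b x - b p + l * ((p - y) \<bullet> h)"
  have "0 \<le> k + s * (l / 2 * (norm h)\<^sup>2)" if s: "0 < s" "s \<le> 1" for s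
  proof -
    have c1: "b (p + s *\<^sub>R h) \<le> (1 - s) * b p + s * b x"
      using convex_onD[OF b, of s p x] s by (simp add: h_def algebra_simps)
    have c2: "g \<bullet> (p + s *\<^sub>R h - y) = g \<bullet> (p - y) + s * (g \<bullet> h)"
      by (simp add: algebra_simps)
    have c3: "(norm (p + s *\<^sub>R h - y))\<^sup>2
        = (norm (p - y))\<^sup>2 + 2 * s * ((p - y) \<bullet> h) + s * s * (norm h)\<^sup>2"
      unfolding power2_norm_eq_inner by (simp add: algebra_simps inner_commute)
    have "0 \<le> s * (g \<bullet> h) + (s * b x - s * b p)
        + l / 2 * (2 * s * ((p - y) \<bullet> h) + s * s * (norm h)\<^sup>2)"
      using min[of "p + s *\<^sub>R h"] c1 unfolding c2 c3 by (simp add: algebra_simps)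
    also have "\<dots> = s * (k + s * (l / 2 * (norm h)\<^sup>2))"
      by (simp add: k_def algebra_simps)
    finally show ?thesis using s by (simp add: zero_le_mult_iff)
  qed
  then have "0 \<le> k" by (rule nonneg_if_affine_nonneg_near_0)
  then show ?thesis by (simp add: k_def h_def inner_add_left)
qed

text \<open>Coercivity: on a ray from \<open>y\<close> a convex \<open>b\<close> falls at most
  linearly, with a slope controlled by its minimum on the unit sphere, so the quadratic term wins
  far away.\<close>

lemma convex_regularised_minimizer_exists:
  fixes b :: "'a::euclidean_space \<Rightarrow> real"
  assumes cont: "continuous_on UNIV b" and conv: "convex_on UNIV b" and l: "l > 0"
  shows "\<exists>p. \<forall>x. g \<bullet> (p - y) + b p + l / 2 * (norm (p - y))\<^sup>2
      \<le> g \<bullet> (x - y) + b x + l / 2 * (norm (x - y))\<^sup>2"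
proof -
  define \<phi> where "\<phi> x = g \<bullet> (x - y) + b x + l / 2 * (norm (x - y))\<^sup>2" for x
  have cb: "continuous_on S b" for S by (rule continuous_on_subset[OF cont]) auto
  have c\<phi>: "continuous_on S \<phi>" for S unfolding \<phi>_def by (intro continuous_intros cb)
  have "sphere y 1 \<noteq> {}" "compact (sphere y 1)" by auto
  then obtain x0 where "\<forall>x \<in> sphere y 1. b x0 \<le> b x"
    using continuous_attains_inf[OF _ _ cb, of "sphere y 1"] by auto
  then have x0: "b x0 \<le> b x" if "norm (x - y) = 1" for x
    using that by (simp add: dist_norm norm_minus_commute)
  define M where "M = \<bar>b x0 - b y\<bar> + norm g"
  \<comment> \<open>The 1 puts the unit-sphere point between \<open>y\<close> and \<open>x\<close>;
    beyond \<open>2 * M / l\<close> the quadratic term exceeds the largest linear loss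
    \<open>M * r\<close>.\<close>
  define R where "R = max 1 (2 * M / l)"
  have far: "\<phi> y \<le> \<phi> x" if x: "norm (x - y) > R" for x
  proof -
    define r where "r = norm (x - y)"
    have r: "r > 1" "r > 2 * M / l" using x by (auto simp: R_def r_def)
    have "b x0 \<le> b (y + (1 / r) *\<^sub>R (x - y))"
      by (rule x0) (use r in \<open>auto simp: r_def\<close>)
    also have "y + (1 / r) *\<^sub>R (x - y) = (1 - 1 / r) *\<^sub>R y + (1 / r) *\<^sub>R x"
      by (simp add: algebra_simps)
    also have "b \<dots> \<le> (1 - 1 / r) * b y + (1 / r) * b x"
      by (rule convex_onD[OF conv]) (use r in auto)
    finally have "r * (b x0 - b y) \<le> b x - b y" using r by (simp add: field_simps)
    moreover have "- (r * \<bar>b x0 - b y\<bar>) \<le> r * (b x0 - b y)"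
      using r mult_left_mono[of "- \<bar>b x0 - b y\<bar>" "b x0 - b y" r] by simp
    moreover have "- (norm g * r) \<le> g \<bullet> (x - y)"
      using Cauchy_Schwarz_ineq2[of g "x - y"] by (simp add: r_def abs_le_iff)
    moreover have "r * M \<le> r * (l / 2 * r)"
      using r l by (intro mult_left_mono) (auto simp: field_simps)
    ultimately have "b y \<le> g \<bullet> (x - y) + b x + l / 2 * r\<^sup>2"
      by (simp add: M_def algebra_simps power2_eq_square)
    then show ?thesis by (simp add: \<phi>_def r_def)
  qed
  have "cball y R \<noteq> {}" "compact (cball y R)" by (auto simp: R_def)
  then obtain p where p: "p \<in> cball y R" "\<And>x. x \<in> cball y R \<Longrightarrow> \<phi> p \<le> \<phi> x"
    using continuous_attains_inf[OF _ _ c\<phi>, of "cball y R"] by metis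
  have "\<phi> p \<le> \<phi> x" for x
  proof (cases "x \<in> cball y R")
    case False
    then have "\<phi> y \<le> \<phi> x" by (intro far) (simp add: dist_norm norm_minus_commute)
    moreover have "\<phi> p \<le> \<phi> y" by (rule p) (simp add: R_def)
    ultimately show ?thesis by simp
  qed (rule p)
  then show ?thesis unfolding \<phi>_def by blast
qed

text \<open>\<open>arg_min\<close> is a choice operator; the existence of a minimiser guarantees
  that \<open>prox_step\<close> attains the minimum.\<close>

lemma prox_step_variational:
  fixes a b :: "real ^ 'n \<Rightarrow> real" and y :: "real ^ 'n"
  assumes "continuous_on UNIV b" "convex_on UNIV b" "l > 0"
  defines "p \<equiv> prox_step a b l y"
  shows "b p - (gradient a y + l *\<^sub>R (p - y)) \<bullet> (x - p) \<le> b x"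
proof (rule convex_regularised_minimizer_variational[OF assms(2)])
  let ?\<phi> = "\<lambda>x. gradient a y \<bullet> (x - y) + b x + l / 2 * (norm (x - y))\<^sup>2"
  obtain q where q: "\<And>x. ?\<phi> q \<le> ?\<phi> x"
    using convex_regularised_minimizer_exists[OF assms(1-3), of "gradient a y" y] by metis
  have "?\<phi> p = ?\<phi> q"
    unfolding p_def prox_step_def
    by (rule arg_min_equality[where f = ?\<phi> and k = q]) (simp, rule q)
  then show "?\<phi> p \<le> ?\<phi> x" for x using q[of x] by (rule ord_eq_le_trans)
qed

section \<open>Accelerated gradient descent\<close>

text \<open>\<open>F\<close> and \<open>F'\<close> stand for optimality gaps and \<open>x\<close>
  for the minimiser. The premises, proximal inequalities at \<open>w\<close> and at
  \<open>x\<close>, are added with weights \<open>lam\<^sup>2 - lam\<close> and \<open>lam\<close>,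
  and the square is completed.\<close>

lemma fista_potential_step:
  fixes w w' x z :: "'a::real_inner"
  assumes "F' + l * ((z - w') \<bullet> (w - z)) + l / 2 * (norm (w' - z))\<^sup>2 \<le> F"
    and "F' + l * ((z - w') \<bullet> (x - z)) + l / 2 * (norm (w' - z))\<^sup>2 \<le> 0"
    and lam: "lam \<ge> 1"
  shows "lam\<^sup>2 * F' + l / 2 * (norm (w + lam *\<^sub>R (w' - w) - x))\<^sup>2
    \<le> (lam\<^sup>2 - lam) * F + l / 2 * (norm (w + lam *\<^sub>R (z - w) - x))\<^sup>2"
proof -
  define e q s where "e = z - w'" and "q = w - z" and "s = x - z"
  have H: "F' + l * (e \<bullet> q) + l / 2 * (e \<bullet> e) \<le> F" "F' + l * (e \<bullet> s) + l / 2 * (e \<bullet> e) \<le> 0"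
    using assms(1,2) by (simp_all add: e_def q_def s_def norm_minus_commute[of w'] power2_norm_eq_inner)
  define U where "U = (1 - lam) *\<^sub>R q - s"
  have U: "w + lam *\<^sub>R (z - w) - x = U" "w + lam *\<^sub>R (w' - w) - x = U - lam *\<^sub>R e"
    by (simp_all add: U_def e_def q_def s_def algebra_simps)
  have "(lam\<^sup>2 - lam) * (F' + l * (e \<bullet> q) + l / 2 * (e \<bullet> e)) \<le> (lam\<^sup>2 - lam) * F"
    using lam H by (intro mult_left_mono) (auto simp: self_le_power)
  moreover have "lam * (F' + l * (e \<bullet> s) + l / 2 * (e \<bullet> e)) \<le> 0"
    using lam H by (simp add: mult_le_0_iff)
  ultimately have "(lam\<^sup>2 - lam) * (F' + l * (e \<bullet> q) + l / 2 * (e \<bullet> e))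
      + lam * (F' + l * (e \<bullet> s) + l / 2 * (e \<bullet> e)) \<le> (lam\<^sup>2 - lam) * F"
    by linarith
  moreover have n: "(norm (U - lam *\<^sub>R e))\<^sup>2 = (norm U)\<^sup>2 - 2 * lam * (e \<bullet> U) + lam\<^sup>2 * (e \<bullet> e)"
    unfolding power2_norm_eq_inner by (simp add: algebra_simps inner_commute power2_eq_square)
  moreover have eU: "e \<bullet> U = (1 - lam) * (e \<bullet> q) - e \<bullet> s" by (simp add: U_def algebra_simps)
  ultimately show ?thesis unfolding U n eU by (simp add: field_simps power2_eq_square)
qed

lemma norm_convex_combination_sq_le:
  fixes p q :: "'a::real_inner"
  assumes "0 \<le> \<theta>" "\<theta> \<le> 1"
  shows "(norm ((1 - \<theta>) *\<^sub>R p + \<theta> *\<^sub>R q))\<^sup>2 \<le> (1 - \<theta>) * (norm p)\<^sup>2 + \<theta> * (norm q)\<^sup>2"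
proof -
  have "(1 - \<theta>) * (norm p)\<^sup>2 + \<theta> * (norm q)\<^sup>2 - (norm ((1 - \<theta>) *\<^sub>R p + \<theta> *\<^sub>R q))\<^sup>2
      = \<theta> * (1 - \<theta>) * (norm (p - q))\<^sup>2"
    unfolding power2_norm_eq_inner by (simp add: algebra_simps inner_commute)
  moreover have "0 \<le> \<theta> * (1 - \<theta>) * (norm (p - q))\<^sup>2" using assms by simp
  ultimately show ?thesis by linarith
qed

text \<open>\<open>X\<close> and \<open>X'\<close> are squared distances of consecutive iterates to
  the minimiser, \<open>P\<close> that of the auxiliary point, \<open>D\<close> that of the start.
  Inserting the bound on \<open>P\<close> into the averaging inequality puts the strong convexity
  term on the side of \<open>X'\<close>; the bound on \<open>X\<close> then closes the
  induction.\<close>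

lemma fista_contraction_step:
  fixes X X' D \<sigma> lam P :: real
  assumes lam: "lam \<ge> 1" and "\<sigma> \<ge> 0" and "D \<ge> 0"
    and X: "X * (1 + \<sigma> * (lam\<^sup>2 - lam) / 2) \<le> D"
    and P: "P \<le> D - \<sigma> * lam\<^sup>2 * X'"
    and X': "lam * X' \<le> (lam - 1) * X + P"
  shows "X' * (1 + \<sigma> * lam\<^sup>2 / 2) \<le> D"
proof -
  define g where "g = \<sigma> * lam / 2"
  have g: "g \<ge> 0" using assms by (simp add: g_def)
  define c where "c = 1 + g * (lam - 1)"
  have c: "c \<ge> 1" using g lam by (simp add: c_def)
  have X2: "X * c \<le> D" using X by (simp add: c_def g_def power2_eq_square algebra_simps)
  have s: "\<sigma> * lam\<^sup>2 = 2 * g * lam" by (simp add: g_def power2_eq_square)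
  have "lam * (1 + 2 * g) * X' \<le> (lam - 1) * X + D" using P X' unfolding s by (simp add: algebra_simps)
  then have "c * (lam * (1 + 2 * g) * X') \<le> c * ((lam - 1) * X + D)" using c by (intro mult_left_mono) auto
  also have "\<dots> = (lam - 1) * (X * c) + c * D" by (simp add: algebra_simps)
  also have "\<dots> \<le> (lam - 1) * D + c * D" using X2 lam by (intro add_right_mono mult_left_mono) auto
  finally have A: "c * lam * (1 + 2 * g) * X' \<le> (lam - 1 + c) * D" by (simp add: algebra_simps)
  have "(1 + g * lam) * (c * lam * (1 + 2 * g) * X') \<le> (1 + g * lam) * ((lam - 1 + c) * D)"
    using A g lam by (intro mult_left_mono) auto
  also have "\<dots> \<le> c * lam * (1 + 2 * g) * D"
  proof -
    \<comment> \<open>The two sides of the next inequality differ by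
      \<open>g + g\<^sup>2 * (lam * (lam - 1))\<close>.\<close>
    have "0 \<le> g\<^sup>2 * (lam * (lam - 1))" using lam by simp
    then have "(1 + g * lam) * (lam - 1 + c) \<le> c * lam * (1 + 2 * g)"
      using g by (simp add: c_def algebra_simps power2_eq_square)
    from mult_right_mono[OF this \<open>D \<ge> 0\<close>] show ?thesis by (simp add: mult.assoc)
  qed
  finally have "(c * lam * (1 + 2 * g)) * (X' * (1 + g * lam)) \<le> (c * lam * (1 + 2 * g)) * D"
    by (simp add: mult_ac)
  moreover have "c * lam * (1 + 2 * g) > 0" using c lam g by (intro mult_pos_pos) auto
  ultimately have "X' * (1 + g * lam) \<le> D" by (simp add: mult_le_cancel_left_pos)
  then show ?thesis unfolding s by (simp add: algebra_simps)
qed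

section \<open>FISTA with backtracking on a composite objective\<close>

locale composite_problem =
  fixes a b :: "real ^ 'n \<Rightarrow> real" and \<alpha> L \<eta> l0 :: real and wstar :: "real ^ 'n"
  assumes alpha_pos: "\<alpha> > 0"
    and strongly_convex: "strongly_convex \<alpha> a"
    and L_smooth: "L_smooth L a"
    and continuous_b: "continuous_on UNIV b"
    and convex_b: "convex_on UNIV b"
    and minimizer: "\<And>x. a wstar + b wstar \<le> a x + b x"
    and eta: "\<eta> > 1"
    and l0_pos: "0 < l0" and l0_le: "l0 \<le> L"
begin

text \<open>By the descent lemma \<open>wstar\<close> minimises its own regularised model with
  \<open>l = L\<close>, which gives a subgradient inequality for \<open>b\<close>; strong convexity
  of \<open>a\<close> supplies the quadratic term.\<close>

lemma quadratic_growth: "a wstar + b wstar + \<alpha> / 2 * (norm (x - wstar))\<^sup>2 \<le> a x + b x"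
proof -
  have "b wstar - (gradient a wstar + L *\<^sub>R (wstar - wstar)) \<bullet> (x - wstar) \<le> b x"
  proof (rule convex_regularised_minimizer_variational[OF convex_b])
    fix y
    have "a wstar + b wstar \<le> a y + b y" by (rule minimizer)
    also have "a y \<le> a wstar + gradient a wstar \<bullet> (y - wstar) + L / 2 * (norm (y - wstar))\<^sup>2"
      using L_smooth_quadratic_upper_bound[OF L_smooth, of wstar "y - wstar"] by simp
    finally show "gradient a wstar \<bullet> (wstar - wstar) + b wstar + L / 2 * (norm (wstar - wstar))\<^sup>2
      \<le> gradient a wstar \<bullet> (y - wstar) + b y + L / 2 * (norm (y - wstar))\<^sup>2" by simp
  qed
  then show ?thesis
    using strongly_convex_quadratic_lower_bound[OF strongly_convex, of wstar "x - wstar"] by simp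
qed

lemma sufficient_decrease_if_ge_L:
  assumes "l \<ge> L" shows "sufficient_decrease a b l z"
proof -
  define p where "p = prox_step a b l z"
  have "a p \<le> a z + gradient a z \<bullet> (p - z) + L / 2 * (norm (p - z))\<^sup>2"
    using L_smooth_quadratic_upper_bound[OF L_smooth, of z "p - z"] by simp
  also have "\<dots> \<le> a z + gradient a z \<bullet> (p - z) + l / 2 * (norm (p - z))\<^sup>2"
    using assms by (intro add_left_mono mult_right_mono) auto
  finally show ?thesis
    by (simp add: sufficient_decrease_def p_def[symmetric] inner_commute)
qed

text \<open>The search ends because powers of \<eta> are unbounded. If it ends at a positive
  exponent, the preceding trial failed and was therefore below \<open>L\<close>, so \<open>L\<close>
  is exceeded by at most a factor \<eta>.\<close>

lemma backtrack_bounds: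
  fixes z :: "real ^ 'n"
  assumes l: "0 < l" "l \<le> \<eta> * L"
  defines "l' \<equiv> backtrack a b \<eta> l z"
  shows "l \<le> l'" "l' \<le> \<eta> * L" "sufficient_decrease a b l' z"
proof -
  define k where "k = (LEAST k. sufficient_decrease a b (\<eta> ^ k * l) z)"
  have l': "l' = \<eta> ^ k * l" by (simp add: l'_def backtrack_def k_def)
  obtain m where "L / l < \<eta> ^ m" using real_arch_pow[OF eta] by blast
  then have "sufficient_decrease a b (\<eta> ^ m * l) z"
    using l by (intro sufficient_decrease_if_ge_L) (simp add: field_simps)
  then show "sufficient_decrease a b l' z" unfolding l' k_def by (rule LeastI)
  show "l \<le> l'" unfolding l' using l eta by (simp add: one_le_power)
  show "l' \<le> \<eta> * L"
  proof (cases k)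
    case 0 then show ?thesis using l by (simp add: l')
  next
    case (Suc j)
    then have "\<not> sufficient_decrease a b (\<eta> ^ j * l) z"
      unfolding k_def using not_less_Least lessI by metis
    then have "\<eta> ^ j * l < L" using sufficient_decrease_if_ge_L by (meson not_less)
    then show ?thesis using eta by (simp add: l' Suc mult.assoc)
  qed
qed

text \<open>Sum of the sufficient decrease test, the subgradient inequality of \<open>b\<close> at
  \<open>p\<close> and the tangent inequality of \<open>a\<close> at \<open>z\<close>.\<close>

lemma prox_gradient_inequality:
  assumes "0 < l" "sufficient_decrease a b l z"
  defines "p \<equiv> prox_step a b l z"
  shows "a p + b p + l * ((z - p) \<bullet> (x - z)) + l / 2 * (norm (p - z))\<^sup>2 \<le> a x + b x"
proof -
  have "a p \<le> a z + (p - z) \<bullet> gradient a z + l / 2 * (norm (p - z))\<^sup>2"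
    using assms by (simp add: sufficient_decrease_def p_def Let_def)
  moreover have "b p - (gradient a z + l *\<^sub>R (p - z)) \<bullet> (x - p) \<le> b x"
    unfolding p_def by (rule prox_step_variational[OF continuous_b convex_b assms(1)])
  moreover have "a z + gradient a z \<bullet> (x - z) \<le> a x"
  proof -
    have "0 \<le> \<alpha> / 2 * (norm (x - z))\<^sup>2" using alpha_pos by simp
    then show ?thesis
      using strongly_convex_quadratic_lower_bound[OF strongly_convex, of z "x - z"] by simp
  qed
  moreover have "(gradient a z + l *\<^sub>R (p - z)) \<bullet> (x - p) = gradient a z \<bullet> (x - z)
      - (p - z) \<bullet> gradient a z - l * ((z - p) \<bullet> (x - z)) - l * (norm (p - z))\<^sup>2"
    unfolding power2_norm_eq_inner by (simp add: algebra_simps inner_commute)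
  ultimately show ?thesis by (simp add: field_simps)
qed

text \<open>Reciprocal of the condition number \<kappa>, which includes the backtracking factor
  \<eta>.\<close>

definition sigma :: real where "sigma = \<alpha> / (L * \<eta>)"

lemma sigma_pos: "sigma > 0"
  using alpha_pos eta l0_pos l0_le by (simp add: sigma_def)

text \<open>The potential bound is the classical one. The last bound comes from
  \<open>w\<^sup>t\<close> being a convex combination of \<open>w\<^sup>t\<^sup>-\<^sup>1\<close> and the auxiliary point
  \<open>u\<^sup>t = w\<^sup>t + \<lambda>\<^sup>t (z\<^sup>t - w\<^sup>t)\<close>, whose distance to the minimiser the potential controls.\<close>

lemma agd_state_invariant:
  assumes "agd_state a b \<eta> l0 v t = (w, z, lam, l)"
  shows "0 < l \<and> l \<le> \<eta> * L \<and> (real t + 2) / 2 \<le> lam \<and>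
    (t \<ge> 1 \<longrightarrow> ((real t + 1) / 2)\<^sup>2 \<le> lam\<^sup>2 - lam) \<and>
    2 * (lam\<^sup>2 - lam) * (a w + b w - (a wstar + b wstar)) / l + (norm (w + lam *\<^sub>R (z - w) - wstar))\<^sup>2
      \<le> (norm (v - wstar))\<^sup>2 \<and>
    (norm (w - wstar))\<^sup>2 * (1 + sigma * (lam\<^sup>2 - lam) / 2) \<le> (norm (v - wstar))\<^sup>2"
  using assms
proof (induction t arbitrary: w z lam l)
  \<comment> \<open>Here \<open>lam = 1\<close> and \<open>lam\<^sup>2 - lam = 0\<close>, so the
    last two bounds are trivial, while the lower bound on \<open>lam\<^sup>2 - lam\<close> only
    holds from \<open>t = 1\<close> on.\<close>
  case 0
  have "l0 * 1 \<le> L * \<eta>" using l0_pos l0_le eta by (intro mult_mono) auto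
  with 0 show ?case using l0_pos by (auto simp: mult.commute)
next
  case (Suc t)
  obtain w0 z0 lam0 k where s0: "agd_state a b \<eta> l0 v t = (w0, z0, lam0, k)"
    by (metis surj_pair)
  note IH = Suc.IH[OF s0]
  define D where "D = (norm (v - wstar))\<^sup>2"
  define F where "F x = a x + b x - (a wstar + b wstar)" for x
  have lam0: "lam0 \<ge> 1" "(real t + 2) / 2 \<le> lam0" using IH by auto
  have "prox_step a b (backtrack a b \<eta> k z0) z0 = w \<and>
      prox_step a b (backtrack a b \<eta> k z0) z0 + ((lam0 - 1) / ((1 + sqrt (1 + 4 * lam0\<^sup>2)) / 2))
        *\<^sub>R (prox_step a b (backtrack a b \<eta> k z0) z0 - w0) = z \<and>
      (1 + sqrt (1 + 4 * lam0\<^sup>2)) / 2 = lam \<and> backtrack a b \<eta> k z0 = l"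
    using Suc.prems unfolding agd_state.simps s0 Let_def prod.case prod.inject .
  note state = conjunct1[OF this] conjunct1[OF conjunct2[OF this]]
    conjunct1[OF conjunct2[OF conjunct2[OF this]]] conjunct2[OF conjunct2[OF conjunct2[OF this]]]
  note l_eq = state(4) and w_eq = state(1)[unfolded state(4)] and lam_eq = state(3)
  note eqs = l_eq[symmetric] w_eq[symmetric] lam_eq[symmetric]
    state(2)[unfolded l_eq w_eq lam_eq, symmetric]
  have l: "k \<le> l" "l \<le> \<eta> * L" "sufficient_decrease a b l z0"
    unfolding eqs(1) by (rule backtrack_bounds; use IH in simp)+
  have k: "k > 0" using IH by simp
  have lpos: "l > 0" using l k by simp
  \<comment> \<open>The recursion picks the positive root of this equation, so the weight left by
    one step is the weight that the next step needs.\<close>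
  have lam_sq: "lam\<^sup>2 - lam = lam0\<^sup>2" unfolding eqs(3) by (simp add: field_simps power2_eq_square)
  have "2 * lam0 \<le> sqrt (1 + 4 * lam0\<^sup>2)" by (rule real_le_rsqrt) (simp add: power2_eq_square)
  then have lam_ge: "lam0 + 1 / 2 \<le> lam" unfolding eqs(3) by simp
  define u where "u = w0 + lam0 *\<^sub>R (w - w0)"
  \<comment> \<open>The extrapolation is designed for this: the auxiliary point left by one step is
    the one from which the next step starts.\<close>
  have u: "w + lam *\<^sub>R (z - w) = u"
  proof -
    have "lam \<noteq> 0" using lam_ge lam0 by linarith
    then have "lam *\<^sub>R (z - w) = (lam0 - 1) *\<^sub>R (w - w0)" by (simp add: eqs(4))
    then show ?thesis by (simp add: u_def algebra_simps)
  qed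
  have Fnn: "F x \<ge> 0" for x using minimizer by (simp add: F_def)
  have "F w + l * ((z0 - w) \<bullet> (w0 - z0)) + l / 2 * (norm (w - z0))\<^sup>2 \<le> F w0"
    using prox_gradient_inequality[OF lpos l(3), of w0] unfolding F_def eqs(2) by simp
  moreover have "F w + l * ((z0 - w) \<bullet> (wstar - z0)) + l / 2 * (norm (w - z0))\<^sup>2 \<le> 0"
    using prox_gradient_inequality[OF lpos l(3), of wstar] unfolding F_def eqs(2) by simp
  ultimately have potential_step: "lam0\<^sup>2 * F w + l / 2 * (norm (u - wstar))\<^sup>2
      \<le> (lam0\<^sup>2 - lam0) * F w0 + l / 2 * (norm (w0 + lam0 *\<^sub>R (z0 - w0) - wstar))\<^sup>2"
    unfolding u_def by (rule fista_potential_step) (rule lam0)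
  have rescale: "2 * A / l + N \<le> 2 * B / l + M" if "A + l / 2 * N \<le> B + l / 2 * M" for A B N M
  proof -
    have "l / 2 * (2 * A / l + N) \<le> l / 2 * (2 * B / l + M)"
      using that lpos by (simp add: distrib_left)
    then show ?thesis using lpos by (simp only: mult_le_cancel_left_pos half_gt_zero)
  qed
  from rescale[OF potential_step] have "2 * lam0\<^sup>2 * F w / l + (norm (u - wstar))\<^sup>2
      \<le> 2 * (lam0\<^sup>2 - lam0) * F w0 / l + (norm (w0 + lam0 *\<^sub>R (z0 - w0) - wstar))\<^sup>2"
    by (simp only: mult.assoc)
  \<comment> \<open>The estimate \<open>l\<close> never falls below its predecessor \<open>k\<close>
    and the gap is nonnegative, so the potential telescopes despite backtracking.\<close>
  also have "2 * (lam0\<^sup>2 - lam0) * F w0 / l \<le> 2 * (lam0\<^sup>2 - lam0) * F w0 / k"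
    using k l Fnn lam0 by (intro divide_left_mono mult_nonneg_nonneg) (auto simp: self_le_power)
  also have "2 * (lam0\<^sup>2 - lam0) * F w0 / k + (norm (w0 + lam0 *\<^sub>R (z0 - w0) - wstar))\<^sup>2 \<le> D"
    using IH by (simp add: F_def D_def)
  finally have pot: "2 * lam0\<^sup>2 * F w / l + (norm (u - wstar))\<^sup>2 \<le> D" by simp
  have "sigma * lam0\<^sup>2 * (norm (w - wstar))\<^sup>2 \<le> 2 * lam0\<^sup>2 * F w / l"
  proof -
    have "sigma * lam0\<^sup>2 * (norm (w - wstar))\<^sup>2 = 2 * lam0\<^sup>2 * (\<alpha> / 2 * (norm (w - wstar))\<^sup>2) / (\<eta> * L)"
      by (simp add: sigma_def mult.commute)
    also have "\<dots> \<le> 2 * lam0\<^sup>2 * F w / (\<eta> * L)"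
      using quadratic_growth[of w] l lpos unfolding F_def
      by (intro divide_right_mono mult_left_mono) auto
    also have "\<dots> \<le> 2 * lam0\<^sup>2 * F w / l"
      using l lpos Fnn by (intro divide_left_mono mult_nonneg_nonneg) auto
    finally show ?thesis .
  qed
  then have P: "(norm (u - wstar))\<^sup>2 \<le> D - sigma * lam0\<^sup>2 * (norm (w - wstar))\<^sup>2" using pot by simp
  have "w - wstar = (1 - 1 / lam0) *\<^sub>R (w0 - wstar) + (1 / lam0) *\<^sub>R (u - wstar)"
    using lam0 by (simp add: u_def algebra_simps)
  then have "(norm (w - wstar))\<^sup>2
      \<le> (1 - 1 / lam0) * (norm (w0 - wstar))\<^sup>2 + (1 / lam0) * (norm (u - wstar))\<^sup>2"
    using norm_convex_combination_sq_le[of "1 / lam0" "w0 - wstar" "u - wstar"] lam0 by simp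
  then have "lam0 * (norm (w - wstar))\<^sup>2 \<le> (lam0 - 1) * (norm (w0 - wstar))\<^sup>2 + (norm (u - wstar))\<^sup>2"
    using lam0 by (simp add: field_simps)
  then have "(norm (w - wstar))\<^sup>2 * (1 + sigma * lam0\<^sup>2 / 2) \<le> D"
    by (rule fista_contraction_step[OF lam0(1) _ _ _ P, rotated -1])
      (use IH sigma_pos in \<open>auto simp: D_def\<close>)
  moreover have "((real (Suc t) + 1) / 2)\<^sup>2 \<le> lam0\<^sup>2" using lam0 by (intro power_mono) auto
  ultimately show ?case
    unfolding lam_sq u using lpos l lam_ge lam0 pot by (simp add: D_def F_def)
qed

text \<open>\<open>y\<close> is the squared relative epoch length. The first bound drops the
  auxiliary point from the potential and uses quadratic growth; the second is the averaging
  bound.\<close>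

lemma agd_contraction:
  assumes "t \<ge> 1"
  defines "y \<equiv> sigma * ((real t + 1) / 2)\<^sup>2"
  shows "y * (norm (agd a b \<eta> l0 v t - wstar))\<^sup>2 \<le> (norm (v - wstar))\<^sup>2"
    and "(1 + y / 2) * (norm (agd a b \<eta> l0 v t - wstar))\<^sup>2 \<le> (norm (v - wstar))\<^sup>2"
proof -
  obtain w z lam l where s: "agd_state a b \<eta> l0 v t = (w, z, lam, l)" by (metis surj_pair)
  define B where "B = lam\<^sup>2 - lam"
  define X where "X = (norm (w - wstar))\<^sup>2"
  define F where "F = a w + b w - (a wstar + b wstar)"
  from agd_state_invariant[OF s] \<open>t \<ge> 1\<close>
  have inv: "0 < l" "l \<le> \<eta> * L" "((real t + 1) / 2)\<^sup>2 \<le> B"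
    "2 * B * F / l + (norm (w + lam *\<^sub>R (z - w) - wstar))\<^sup>2 \<le> (norm (v - wstar))\<^sup>2"
    "X * (1 + sigma * B / 2) \<le> (norm (v - wstar))\<^sup>2"
    by (auto simp: B_def X_def F_def)
  have w: "agd a b \<eta> l0 v t = w" by (simp add: agd_def s)
  have yB: "y \<le> sigma * B" unfolding y_def using inv(3) sigma_pos by simp
  have B0: "B \<ge> 0" using inv(3) by (meson order_trans zero_le_power2)
  have F: "\<alpha> / 2 * X \<le> F" using quadratic_growth[of w] by (simp add: F_def X_def)
  then have F0: "F \<ge> 0" using minimizer[of w] by (simp add: F_def)
  have "sigma * B * X = 2 * B * (\<alpha> / 2 * X) / (\<eta> * L)" by (simp add: sigma_def mult.commute)
  also have "\<dots> \<le> 2 * B * F / (\<eta> * L)"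
    using F B0 inv by (intro divide_right_mono mult_left_mono) auto
  also have "\<dots> \<le> 2 * B * F / l"
    using inv F0 B0 by (intro divide_left_mono mult_nonneg_nonneg) auto
  also have "\<dots> \<le> (norm (v - wstar))\<^sup>2"
    using inv(4) by (smt (verit) zero_le_power2)
  finally have "sigma * B * X \<le> (norm (v - wstar))\<^sup>2" .
  moreover have "y * X \<le> sigma * B * X" using yB by (intro mult_right_mono) (auto simp: X_def)
  ultimately show "y * (norm (agd a b \<eta> l0 v t - wstar))\<^sup>2 \<le> (norm (v - wstar))\<^sup>2"
    by (simp add: w X_def)
  have "(1 + y / 2) * X \<le> (1 + sigma * B / 2) * X"
    using yB by (intro mult_right_mono) (auto simp: X_def)
  then show "(1 + y / 2) * (norm (agd a b \<eta> l0 v t - wstar))\<^sup>2 \<le> (norm (v - wstar))\<^sup>2"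
    using inv(5) by (simp add: w X_def mult.commute)
qed

end

section \<open>Adaptive restarts\<close>

text \<open>An epoch of relative length \<open>r = (t + 1) / c\<close> moves the iterate at least
  \<open>r\<^sup>2 / progress_const r\<close> times the final distance to the minimiser. The branch for short
  epochs uses the second bound of the contraction lemma, the other one the classical bound.\<close>

definition progress_const :: "real \<Rightarrow> real"
  where "progress_const r = (if r \<le> 3 / 2 then 5 else r\<^sup>2 / (r - 1))"

text \<open>\<open>progress_const\<close> is not monotone: it drops from 5 to about 9/2 just beyond
  3/2, stays at most 9/2 up to 3 and increases afterwards. Hence only 5 and the value at
  \<open>R\<close> matter.\<close>

lemma progress_const_le:
  assumes "r \<le> R" "5 \<le> M" "R\<^sup>2 \<le> M * (R - 1)"
  shows "progress_const r \<le> M"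
proof -
  consider "r \<le> 3 / 2" | "3 / 2 < r" "r \<le> 3" | "3 < r" by linarith
  then show ?thesis
  proof cases
    case 2
    then have "0 \<le> (2 * r - 3) * (3 - r)" by simp
    then have "r\<^sup>2 \<le> 9 / 2 * (r - 1)" by (simp add: algebra_simps power2_eq_square)
    also have "\<dots> \<le> M * (r - 1)" using assms 2 by (intro mult_right_mono) auto
    finally show ?thesis using 2 by (simp add: progress_const_def divide_le_eq)
  next
    case 3
    have "1 * 2 \<le> (r - 1) * (R - 1)" using 3 assms by (intro mult_mono) auto
    then have "0 \<le> (R - r) * ((r - 1) * (R - 1) - 1)" using assms by simp
    then have "r\<^sup>2 * (R - 1) \<le> R\<^sup>2 * (r - 1)" by (simp add: algebra_simps power2_eq_square)
    also have "\<dots> \<le> M * (R - 1) * (r - 1)" using assms 3 by (intro mult_right_mono) auto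
    finally have "(R - 1) * r\<^sup>2 \<le> (R - 1) * (M * (r - 1))" by (simp add: mult_ac)
    then have "r\<^sup>2 \<le> M * (r - 1)" using 3 assms by (simp add: mult_le_cancel_left_pos)
    then show ?thesis using 3 by (simp add: progress_const_def divide_le_eq)
  qed (use assms in \<open>simp add: progress_const_def\<close>)
qed

text \<open>Short epochs: \<open>5 * d < r\<^sup>2 * X\<close> would give
  \<open>D \<le> (1 + r\<^sup>2 / 5) * X\<close>, and squaring against the improved bound forces
  \<open>r\<^sup>2 \<ge> 5 / 2\<close>, more than \<open>(3 / 2)\<^sup>2\<close>. Long epochs:
  \<open>r * X \<le> D \<le> X + d\<close>.\<close>

lemma progress_bound:
  fixes r X D d :: real
  assumes r: "0 < r" and "0 \<le> X" "0 \<le> D" "0 \<le> d"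
    and classical: "r\<^sup>2 * X\<^sup>2 \<le> D\<^sup>2"
    and improved: "(1 + r\<^sup>2 / 2) * X\<^sup>2 \<le> D\<^sup>2"
    and tri: "D \<le> X + d"
  shows "r\<^sup>2 * X \<le> progress_const r * d"
proof (cases "r \<le> 3 / 2")
  case True
  have "r\<^sup>2 * X \<le> 5 * d"
  proof (rule ccontr)
    assume neg: "\<not> r\<^sup>2 * X \<le> 5 * d"
    then have X: "X > 0" using assms by (cases "X = 0") auto
    have "D \<le> (1 + r\<^sup>2 / 5) * X" using neg tri by (simp add: algebra_simps)
    then have "D\<^sup>2 \<le> ((1 + r\<^sup>2 / 5) * X)\<^sup>2" using assms by (intro power_mono) auto
    then have "(1 + r\<^sup>2 / 2) * X\<^sup>2 \<le> (1 + r\<^sup>2 / 5)\<^sup>2 * X\<^sup>2"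
      using improved by (simp add: power_mult_distrib)
    then have "1 + r\<^sup>2 / 2 \<le> (1 + r\<^sup>2 / 5)\<^sup>2" using X by simp
    then have "r\<^sup>2 * (5 / 2) \<le> r\<^sup>2 * r\<^sup>2" by (simp add: power2_eq_square algebra_simps)
    then have "5 / 2 \<le> r\<^sup>2" using r by (simp only: mult_le_cancel_left_pos zero_less_power)
    moreover have "r\<^sup>2 \<le> (3 / 2)\<^sup>2" using True r by (intro power_mono) auto
    ultimately show False by (simp add: power2_eq_square)
  qed
  then show ?thesis using True by (simp add: progress_const_def)
next
  case False
  have "(r * X)\<^sup>2 \<le> D\<^sup>2" using classical by (simp add: power_mult_distrib)
  then have "r * X \<le> D" using assms by (simp add: power2_le_iff_abs_le)
  then have "X * (r - 1) \<le> d" using tri by (simp add: algebra_simps)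
  then have "r\<^sup>2 * (X * (r - 1)) \<le> r\<^sup>2 * d" by (intro mult_left_mono) auto
  then show ?thesis using False by (simp add: progress_const_def field_simps)
qed

section \<open>Numerical inequalities for the restart constants\<close>

text \<open>In the application \<open>c = 2 \<surd>\<kappa>\<close> and \<open>t\<^sup>* = 1 + c q\<close>; the equation for \<open>q\<close> is
  equivalent to \<open>q\<^sup>2 = \<rho> (q + 1)\<close>.\<close>

locale restart_constants =
  fixes \<beta> q c :: real
  assumes beta: "0 < \<beta>" "\<beta> < 1" and q_pos: "0 < q" and c_ge: "2 \<le> c"
    and q_eq: "\<beta> * q\<^sup>2 = (1 + \<beta>) * (q + 1)"
begin

text \<open>\<open>\<beta> < 1\<close> forces \<open>q\<^sup>2 \<ge> 2 * (q + 1)\<close>, hence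
  \<open>q \<ge> 1 + sqrt 3\<close>, which is slightly above 5/2.\<close>

lemma q_ge: "q \<ge> 5 / 2"
proof (rule ccontr)
  assume neg: "\<not> q \<ge> 5 / 2"
  have "\<beta> * 2 * (q + 1) \<le> (1 + \<beta>) * (q + 1)"
    using beta q_pos by (intro mult_right_mono) auto
  then have "\<beta> * (2 * (q + 1)) \<le> \<beta> * q\<^sup>2" by (simp only: q_eq mult.assoc)
  then have "2 * (q + 1) \<le> q\<^sup>2" using beta by (simp only: mult_le_cancel_left_pos)
  then have "2 \<le> q * (q - 2)" by (simp add: algebra_simps power2_eq_square)
  moreover have "q * (q - 2) \<le> q * (1 / 2)" using neg q_pos by (intro mult_left_mono) auto
  ultimately show False using neg by simp
qed

lemma beta_q_ge: "1 + \<beta> \<le> \<beta> * q"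
proof -
  have "(1 + \<beta>) * q \<le> (1 + \<beta>) * (q + 1)" using beta by simp
  also have "\<dots> = (\<beta> * q) * q" by (simp flip: q_eq add: power2_eq_square)
  finally show ?thesis using q_pos by simp
qed

text \<open>Solved for \<open>1 + \<beta>\<close>, the relation lets \<beta> be eliminated:
  multiplying by \<open>q\<^sup>2 - q - 1\<close> leaves polynomial inequalities in
  \<open>q\<close>.\<close>

lemma beta_eq: "(1 + \<beta>) * (q\<^sup>2 - q - 1) = q\<^sup>2"
  using q_eq by (simp add: algebra_simps)

lemma W_pos: "q\<^sup>2 - q - 1 > 0"
  using beta_eq beta q_pos by (metis add_pos_pos zero_less_mult_pos zero_less_one zero_less_power)

lemma five_le: "5 \<le> (1 + \<beta>) * q"
proof -
  \<comment> \<open>Positivity certificate; 11/4 is close to the positive critical point of the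
    cubic.\<close>
  have "q ^ 3 - 5 * (q\<^sup>2 - q - 1) = (q - 11 / 4)\<^sup>2 * (q + 1 / 2) + 3 / 16 * q + 39 / 32"
    by (simp add: power2_eq_square power3_eq_cube field_simps)
  moreover have "0 \<le> (q - 11 / 4)\<^sup>2 * (q + 1 / 2)" using q_pos by simp
  ultimately have "5 * (q\<^sup>2 - q - 1) \<le> q ^ 3" using q_pos by linarith
  also have "\<dots> = (1 + \<beta>) * q * (q\<^sup>2 - q - 1)"
    using beta_eq by (simp add: power3_eq_cube power2_eq_square mult_ac)
  finally show ?thesis using W_pos by (simp only: mult_le_cancel_right_pos)
qed

lemma q_le: "q \<le> (1 + \<beta>) * (q - 1)"
proof -
  have "q * (q\<^sup>2 - q - 1) \<le> q\<^sup>2 * (q - 1)" using q_pos by (simp add: algebra_simps power2_eq_square)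
  also have "\<dots> = (1 + \<beta>) * (q - 1) * (q\<^sup>2 - q - 1)"
    by (subst beta_eq[symmetric]) (simp only: mult_ac)
  finally show ?thesis using W_pos by simp
qed

text \<open>At \<open>s = q\<close> this is \<open>q_eq\<close>. In \<open>s - q\<close> the left
  side has slope \<open>2 * (1 + \<beta>)\<close>, at most the initial slope
  \<open>2 * \<beta> * q\<close> of the convex right side.\<close>

lemma beta_sq_ge:
  assumes "q \<le> s"
  shows "(1 + \<beta>) * (s + 1 + (s - q)) \<le> \<beta> * s\<^sup>2"
proof -
  define x where "x = s - q"
  have x: "x \<ge> 0" "s = q + x" using assms by (auto simp: x_def)
  have "(1 + \<beta>) * x \<le> \<beta> * q * x" using beta_q_ge x by (intro mult_right_mono) auto
  moreover have "0 \<le> \<beta> * x * x" using beta x by simp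
  ultimately show ?thesis
    using q_eq unfolding x(2) by (simp add: algebra_simps power2_eq_square)
qed

text \<open>\<open>r\<close> is the relative length of the previous epoch and \<open>s\<close> that
  of a candidate stopping time. The displacement after the candidate is at most
  \<open>progress_const r * (s + 1) / s ^ 3\<close> times the previous one, each divided by its
  squared length; the test asks for a factor \<beta>.\<close>

lemma criterion_constant:
  assumes s: "q \<le> s" and r: "r \<le> 2 * s - q"
  shows "progress_const r * (s + 1) \<le> \<beta> * s ^ 3"
proof -
  define x where "x = s - q"
  define R where "R = s + x"
  \<comment> \<open>Chosen so that \<open>M * (s + 1)\<close> is \<open>s\<close> times the left
    side of \<open>beta_sq_ge\<close>.\<close>
  define M where "M = (1 + \<beta>) * s * (s + 1 + x) / (s + 1)"
  have x: "x \<ge> 0" "q = s - x" using s by (auto simp: x_def)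
  have s0: "s > 1" using s q_ge by simp
  have "progress_const r \<le> M"
  proof (rule progress_const_le)
    show "r \<le> R" using r by (simp add: R_def x_def)
    have "5 \<le> (1 + \<beta>) * q" by (rule five_le)
    also have "\<dots> \<le> (1 + \<beta>) * s" using s beta by simp
    also have "\<dots> * (s + 1) \<le> (1 + \<beta>) * s * (s + 1 + x)"
      using x s0 beta by (intro mult_left_mono) auto
    then have "(1 + \<beta>) * s \<le> M" unfolding M_def using s0 by (simp add: le_divide_eq)
    finally show "5 \<le> M" .
    \<comment> \<open>As \<open>R\<^sup>2 - 1 = (s + 1 + x) * (R - 1)\<close>, the goal is
      \<open>R\<^sup>2 * (s + 1) \<le> (1 + \<beta>) * s * (R\<^sup>2 - 1)\<close>;
      \<open>q_le\<close> removes \<beta> from it.\<close>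
    have "q * s \<le> R\<^sup>2" unfolding power2_eq_square R_def using x s0 q_pos by (intro mult_mono) auto
    also have "\<dots> \<le> R\<^sup>2 * (x + 1)" using x mult_left_mono[of 1 "x + 1" "R\<^sup>2"] by simp
    finally have "R\<^sup>2 * (s + 1) * (q - 1) \<le> q * s * (R\<^sup>2 - 1)"
      unfolding x(2) by (simp add: algebra_simps)
    also have "\<dots> \<le> (1 + \<beta>) * (q - 1) * s * (R\<^sup>2 - 1)"
      using q_le s0 x by (intro mult_right_mono) (auto simp: R_def)
    finally have "(q - 1) * (R\<^sup>2 * (s + 1)) \<le> (q - 1) * ((1 + \<beta>) * s * (R\<^sup>2 - 1))"
      by (simp only: mult_ac)
    then have "R\<^sup>2 * (s + 1) \<le> (1 + \<beta>) * s * (R\<^sup>2 - 1)" using q_ge by simp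
    also have "R\<^sup>2 - 1 = (s + 1 + x) * (R - 1)" by (simp add: R_def algebra_simps power2_eq_square)
    finally have "R\<^sup>2 * (s + 1) \<le> (1 + \<beta>) * s * (s + 1 + x) * (R - 1)" by (simp only: mult.assoc)
    then show "R\<^sup>2 \<le> M * (R - 1)" unfolding M_def using s0 by (simp add: pos_le_divide_eq)
  qed
  then have "progress_const r * (s + 1) \<le> M * (s + 1)" using s0 by (intro mult_right_mono) auto
  also have "\<dots> = (1 + \<beta>) * (s + 1 + x) * s" unfolding M_def using s0 by simp
  also have "\<dots> \<le> \<beta> * s\<^sup>2 * s" using beta_sq_ge[OF s] s0 by (intro mult_right_mono) (auto simp: x_def)
  finally show ?thesis by (simp add: power2_eq_square power3_eq_cube mult.assoc)
qed

text \<open>For the overall estimate: \<open>r1\<close> and \<open>r\<close> are the relative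
  lengths of the first and the last epoch, and \<open>x\<close> is \<open>r1\<close> enlarged to at
  least \<open>q\<close>.\<close>

lemma final_constant:
  assumes "q \<le> x" "0 < r1" "r1 \<le> x" "r \<le> x + 1"
  shows "progress_const r * (r1 + 1) \<le> 2 * \<beta> * x ^ 3"
proof -
  define M where "M = 2 * \<beta> * x ^ 3 / (x + 1)"
  have x: "x \<ge> 5 / 2" using assms q_ge by simp
  have *: "(1 + \<beta>) * (x + 1) \<le> \<beta> * x\<^sup>2"
  proof -
    have "(1 + \<beta>) * (x + 1) \<le> (1 + \<beta>) * (x + 1 + (x - q))"
      using beta assms by (intro mult_left_mono) auto
    then show ?thesis using beta_sq_ge[OF assms(1)] by simp
  qed
  have "progress_const r \<le> M"
  proof (rule progress_const_le)
    show "r \<le> x + 1" by fact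
    have "5 \<le> (1 + \<beta>) * q" by (rule five_le)
    also have "\<dots> \<le> (1 + \<beta>) * x" using assms beta by simp
    also have "\<dots> * (x + 1) \<le> \<beta> * x ^ 3"
      using mult_right_mono[OF *, of x] x by (simp add: power2_eq_square power3_eq_cube mult_ac)
    then have "(1 + \<beta>) * x \<le> \<beta> * x ^ 3 / (x + 1)" using x by (simp add: pos_le_divide_eq)
    also have "\<dots> \<le> M" unfolding M_def using x beta by (intro divide_right_mono) auto
    finally show "5 \<le> M" .
    \<comment> \<open>The factor 2 in \<open>M\<close>, and with it the 2 in
      \<open>2 / \<epsilon>\<close>, pays for
      \<open>(x + 1)\<^sup>2 \<le> 2 * x\<^sup>2\<close>.\<close>
    have "1 / 2 * (5 / 2) \<le> (x - 2) * x" using x by (intro mult_mono) auto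
    then have "(x + 1)\<^sup>2 \<le> 2 * x\<^sup>2" by (simp add: power2_eq_square algebra_simps)
    then have "(x + 1)\<^sup>2 * (x + 1) \<le> 2 * x\<^sup>2 * (x + 1)" using x by (intro mult_right_mono) auto
    also have "\<dots> \<le> 2 * x\<^sup>2 * ((1 + \<beta>) * (x + 1))" using x beta
      by (intro mult_left_mono) (auto simp: algebra_simps)
    also have "\<dots> \<le> 2 * x\<^sup>2 * (\<beta> * x\<^sup>2)" using * by (intro mult_left_mono) auto
    finally have "(x + 1)\<^sup>2 * (x + 1) \<le> 2 * \<beta> * x ^ 3 * x"
      by (simp add: power2_eq_square power3_eq_cube mult_ac)
    then show "(x + 1)\<^sup>2 \<le> M * (x + 1 - 1)" unfolding M_def using x by (simp add: pos_le_divide_eq)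
  qed
  moreover have "0 \<le> M" unfolding M_def using x beta by simp
  ultimately have "progress_const r * (r1 + 1) \<le> M * (x + 1)" using assms
    by (meson mult_mono add_right_mono add_nonneg_nonneg less_imp_le order_trans mult_right_mono mult_left_mono zero_le_one)
  also have "\<dots> = 2 * \<beta> * x ^ 3" unfolding M_def using x by simp
  finally show ?thesis .
qed

end

section \<open>Lengths and progress of the epochs in a restarted run\<close>

locale restarted_agd = composite_problem a b \<alpha> L \<eta> l0 wstar + restart_constants \<beta> q c
  for a b :: "real ^ 'n \<Rightarrow> real" and \<alpha> L \<eta> l0 :: real and wstar :: "real ^ 'n"
    and \<beta> q c :: real +
  fixes v :: "nat \<Rightarrow> real ^ 'n" and \<tau> :: "nat \<Rightarrow> nat"
  assumes c_sq: "sigma * c\<^sup>2 = 4"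
    and restarted: "adaptively_restarted_agd a b \<eta> l0 \<beta> (v 0) v \<tau>"
begin

lemma sigma_eq: "sigma * ((real t + 1) / 2)\<^sup>2 = ((real t + 1) / c)\<^sup>2"
proof -
  have "sigma = 4 / c\<^sup>2" using c_sq c_ge by (simp add: field_simps)
  then show ?thesis by (simp add: power_divide)
qed

lemma epoch_progress:
  assumes "t \<ge> 1"
  shows "((real t + 1) / c)\<^sup>2 * norm (agd a b \<eta> l0 u t - wstar)
    \<le> progress_const ((real t + 1) / c) * norm (agd a b \<eta> l0 u t - u)"
proof (rule progress_bound[where D = "norm (u - wstar)"])
  show "norm (u - wstar) \<le> norm (agd a b \<eta> l0 u t - wstar) + norm (agd a b \<eta> l0 u t - u)"
    by norm
qed (use agd_contraction[OF assms, of u] c_ge in \<open>simp_all add: sigma_eq\<close>)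

text \<open>The converse control, from the classical bound and the triangle inequality: the starting
  distance limits the displacement.\<close>

lemma epoch_distance:
  assumes "t \<ge> 1"
  shows "norm (agd a b \<eta> l0 u t - u) \<le> norm (u - wstar) * (1 + 1 / ((real t + 1) / c))"
proof -
  define s where "s = (real t + 1) / c"
  have s: "s > 0" unfolding s_def using c_ge by (simp add: add_nonneg_pos)
  have "(s * norm (agd a b \<eta> l0 u t - wstar))\<^sup>2 \<le> (norm (u - wstar))\<^sup>2"
    using agd_contraction(1)[OF assms, of u]
    unfolding sigma_eq s_def[symmetric] by (simp only: power_mult_distrib)
  then have "s * norm (agd a b \<eta> l0 u t - wstar) \<le> norm (u - wstar)"
    by (rule power2_le_imp_le) simp
  then have "norm (agd a b \<eta> l0 u t - wstar) \<le> norm (u - wstar) / s"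
    using s by (simp add: field_simps)
  moreover have "norm (agd a b \<eta> l0 u t - u) \<le> norm (u - wstar) + norm (agd a b \<eta> l0 u t - wstar)"
    by norm
  ultimately show ?thesis by (simp add: distrib_left s_def)
qed

text \<open>The predicate under \<open>LEAST\<close>, isolated because \<open>LEAST\<close> says
  nothing until some \<open>t\<close> is shown to satisfy it.\<close>

definition stopping :: "nat \<Rightarrow> nat \<Rightarrow> bool"
  where "stopping i t \<longleftrightarrow> 1 \<le> t \<and>
    norm (agd a b \<eta> l0 (v (i - 1)) t - v (i - 1)) / (real t + 1)\<^sup>2
      \<le> \<beta> * (norm (v (i - 1) - v (i - 2)) / (real (\<tau> (i - 1)) + 1)\<^sup>2)"

lemma tau_eq: "i > 1 \<Longrightarrow> \<tau> i = (LEAST t. stopping i t)"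
  using restarted unfolding adaptively_restarted_agd_def stopping_def by blast

lemma v_Suc: "v (Suc i) = agd a b \<eta> l0 (v i) (\<tau> (Suc i))"
  using restarted unfolding adaptively_restarted_agd_def
  by (metis diff_Suc_1 le_add1 plus_1_eq_Suc)

text \<open>The previous displacement bounds the distance to the minimiser, which bounds the new
  displacement; \<open>criterion_constant\<close> compares the product of the two factors with
  \<beta>.\<close>

lemma stopping_holds:
  assumes i: "\<tau> (Suc i) \<ge> 1" and t: "t \<ge> 1"
    and s: "q \<le> (real t + 1) / c"
    and r: "(real (\<tau> (Suc i)) + 1) / c \<le> 2 * ((real t + 1) / c) - q"
  shows "stopping (Suc (Suc i)) t"
proof -
  define T r s where "T = real (\<tau> (Suc i)) + 1" and "r = T / c" and "s = (real t + 1) / c"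
  define d where "d = norm (v (Suc i) - v i)"
  define D where "D = norm (v (Suc i) - wstar)"
  have c: "c > 0" using c_ge by simp
  have pos: "T > 0" "r > 0" "s > 0" using c by (auto simp: T_def r_def s_def add_nonneg_pos)
  have prog: "r\<^sup>2 * D \<le> progress_const r * d"
    using epoch_progress[OF i, of "v i"] by (simp add: r_def T_def D_def d_def v_Suc)
  have "norm (agd a b \<eta> l0 (v (Suc i)) t - v (Suc i)) \<le> D * (1 + 1 / s)"
    using epoch_distance[OF t, of "v (Suc i)"] by (simp only: D_def s_def)
  then have "norm (agd a b \<eta> l0 (v (Suc i)) t - v (Suc i)) * (s * r\<^sup>2) \<le> D * (1 + 1 / s) * (s * r\<^sup>2)"
    using pos(3) by (intro mult_right_mono) simp_all
  also have "\<dots> = (s + 1) * (r\<^sup>2 * D)" using pos by (simp add: field_simps)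
  also have "\<dots> \<le> (s + 1) * (progress_const r * d)" using prog pos by (intro mult_left_mono) auto
  also have "\<dots> = progress_const r * (s + 1) * d" by simp
  also have "\<dots> \<le> \<beta> * s ^ 3 * d"
    using criterion_constant[of s r] assms by (intro mult_right_mono) (auto simp: r_def s_def T_def d_def)
  finally have "s * (norm (agd a b \<eta> l0 (v (Suc i)) t - v (Suc i)) * r\<^sup>2) \<le> s * (\<beta> * d * s\<^sup>2)"
    by (simp add: power2_eq_square power3_eq_cube mult_ac)
  then have "norm (agd a b \<eta> l0 (v (Suc i)) t - v (Suc i)) * r\<^sup>2 \<le> \<beta> * d * s\<^sup>2"
    using pos by simp
  then have "norm (agd a b \<eta> l0 (v (Suc i)) t - v (Suc i)) * T\<^sup>2 \<le> \<beta> * d * (real t + 1)\<^sup>2"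
    using c by (simp add: r_def s_def power_divide divide_right_mono divide_le_cancel)
  then show ?thesis
    using t pos by (simp add: stopping_def T_def[symmetric] d_def[symmetric] pos_divide_le_eq
        pos_le_divide_eq add_nonneg_pos)
qed

lemma next_epoch:
  assumes i: "\<tau> (Suc i) \<ge> 1"
  shows "stopping (Suc (Suc i)) (\<tau> (Suc (Suc i)))"
    and "real (\<tau> (Suc (Suc i))) \<le> max (1 + c * q) ((1 + c * q + real (\<tau> (Suc i))) / 2)"
proof -
  define m where "m = max (c * q) ((c * q + (real (\<tau> (Suc i)) + 1)) / 2)"
  \<comment> \<open>Relative lengths count \<open>t + 1\<close>, so \<open>m\<close> bounds
    \<open>t + 1\<close> from below; \<open>m \<ge> 5\<close> makes \<open>t\<close>
    positive.\<close>
  define t where "t = nat \<lceil>m - 1\<rceil>"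
  have c: "c > 0" using c_ge by simp
  have "2 * (5 / 2) \<le> c * q" using c_ge q_ge by (intro mult_mono) auto
  then have m: "m \<ge> 5" by (simp add: m_def)
  have t: "m \<le> real t + 1" "real t \<le> m" using m by (auto simp: t_def)
  have "c * q \<le> real t + 1" "c * q + (real (\<tau> (Suc i)) + 1) \<le> 2 * (real t + 1)"
    using t(1) by (auto simp: m_def)
  note t_ge = this
  have stop: "stopping (Suc (Suc i)) t"
  proof (rule stopping_holds[OF i])
    show "t \<ge> 1" using t(1) m by simp
    show "q \<le> (real t + 1) / c" using t_ge(1) c by (simp add: pos_le_divide_eq mult.commute)
    show "(real (\<tau> (Suc i)) + 1) / c \<le> 2 * ((real t + 1) / c) - q"
      using divide_right_mono[OF t_ge(2), of c] c
      by (simp add: add_divide_distrib[of "c * q"])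
  qed
  have tau: "\<tau> (Suc (Suc i)) = (LEAST t. stopping (Suc (Suc i)) t)" by (rule tau_eq) simp
  show "stopping (Suc (Suc i)) (\<tau> (Suc (Suc i)))" unfolding tau by (rule LeastI, rule stop)
  have "real (\<tau> (Suc (Suc i))) \<le> real t" unfolding tau of_nat_le_iff by (rule Least_le, rule stop)
  also have "\<dots> \<le> m" by (rule t)
  also have "\<dots> \<le> max (1 + c * q) ((1 + c * q + real (\<tau> (Suc i))) / 2)"
    unfolding m_def by (intro max.mono) auto
  finally show "real (\<tau> (Suc (Suc i))) \<le> max (1 + c * q) ((1 + c * q + real (\<tau> (Suc i))) / 2)" .
qed

lemma tau_ge_1: "\<tau> (Suc i) \<ge> 1"
proof (induction i)
  case 0
  then show ?case using restarted by (simp add: adaptively_restarted_agd_def)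
next
  case (Suc i)
  then show ?case using next_epoch(1) unfolding stopping_def by blast
qed

abbreviation tau_bound :: real where "tau_bound \<equiv> 1 + c * q"

lemma tau_le: "real (\<tau> (Suc i)) \<le> max tau_bound (real (\<tau> 1))"
proof (induction i)
  case (Suc i)
  then show ?case using next_epoch(2)[OF tau_ge_1, of i] by (auto simp: max_def split: if_splits)
qed simp

text \<open>The excess of a length over \<open>tau_bound\<close> at least halves in each epoch, so
  the excesses sum to at most twice the first; the subtracted last excess makes the induction
  work.\<close>

lemma sum_tau_le:
  "(\<Sum>i=1..Suc n. real (\<tau> i)) \<le> tau_bound * real (Suc n) + 2 * max (real (\<tau> 1) - tau_bound) 0
    - max (real (\<tau> (Suc n)) - tau_bound) 0"
proof (induction n)
  case (Suc n)
  have "2 * max (real (\<tau> (Suc (Suc n))) - tau_bound) 0 \<le> max (real (\<tau> (Suc n)) - tau_bound) 0"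
    using next_epoch(2)[OF tau_ge_1, of n] by (auto simp: max_def split: if_splits)
  moreover have "S + T' \<le> A + tau_bound + 2 * e1 - e''"
    if "2 * e'' \<le> e'" "T' - tau_bound \<le> e''" "S \<le> A + 2 * e1 - e'" for S T' A e1 e' e'' :: real
    using that by linarith
  ultimately have "(\<Sum>i=1..Suc n. real (\<tau> i)) + real (\<tau> (Suc (Suc n)))
      \<le> tau_bound * real (Suc n) + tau_bound + 2 * max (real (\<tau> 1) - tau_bound) 0
        - max (real (\<tau> (Suc (Suc n))) - tau_bound) 0"
    using Suc by (meson max.cobounded1)
  then show ?case by (simp add: algebra_simps)
qed (simp add: max_def)

lemma displacement_decay:
  "norm (v (Suc n) - v n) / (real (\<tau> (Suc n)) + 1)\<^sup>2
    \<le> \<beta> ^ n * (norm (v 1 - v 0) / (real (\<tau> 1) + 1)\<^sup>2)"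
proof (induction n)
  case (Suc n)
  have "norm (v (Suc (Suc n)) - v (Suc n)) / (real (\<tau> (Suc (Suc n))) + 1)\<^sup>2
      \<le> \<beta> * (norm (v (Suc n) - v n) / (real (\<tau> (Suc n)) + 1)\<^sup>2)"
    using next_epoch(1)[OF tau_ge_1, of n] by (simp add: stopping_def v_Suc)
  also have "\<dots> \<le> \<beta> * (\<beta> ^ n * (norm (v 1 - v 0) / (real (\<tau> 1) + 1)\<^sup>2))"
    using beta by (intro mult_left_mono Suc) auto
  finally show ?case by (simp add: mult.assoc)
qed simp

text \<open>\<open>epoch_progress\<close> for the last epoch, \<open>displacement_decay\<close> back
  to the first and \<open>epoch_distance\<close> there. \<open>R\<close> compensates for a short
  first epoch and enters cubed, whence the 3 before the second logarithm.\<close>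

lemma distance_le:
  defines "R \<equiv> max 1 (tau_bound / real (\<tau> 1))"
  shows "norm (v (Suc n) - wstar) \<le> 2 * \<beta> ^ Suc n * R ^ 3 * norm (v 0 - wstar)"
proof -
  define r where "r i = (real (\<tau> i) + 1) / c" for i
  define K where "K = progress_const (r (Suc n))"
  define x where "x = r 1 * R"
  have c: "c > 0" using c_ge by simp
  have r: "r i > 0" for i using c by (simp add: r_def add_nonneg_pos)
  have tau1: "real (\<tau> 1) \<ge> 1" using tau_ge_1[of 0] by simp
  have R: "R \<ge> 1" "tau_bound \<le> R * real (\<tau> 1)" using tau1 by (auto simp: R_def max_def field_simps)
  have xc: "c * x = (real (\<tau> 1) + 1) * R" using c by (simp add: x_def r_def)
  have "tau_bound \<le> c * x" using R unfolding xc by (simp add: algebra_simps)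
  then have "c * q \<le> c * x" by simp
  then have qx: "q \<le> x" using c by simp
  have r1x: "r 1 \<le> x" unfolding x_def using R r[of 1] by (simp add: mult_le_cancel_left1)
  \<comment> \<open>The extra 1 from counting \<open>t + 1\<close> is absorbed by \<open>c\<close>,
    giving \<open>x + 1\<close> as the bound on the last relative length.\<close>
  have "c * r (Suc n) \<le> max tau_bound (real (\<tau> 1)) + 1" using tau_le[of n] c by (simp add: r_def)
  also have "\<dots> \<le> c * x + c"
  proof -
    have "c * r 1 \<le> c * x" using r1x c by simp
    then have "real (\<tau> 1) + 1 \<le> c * x" using c by (simp add: r_def)
    then show ?thesis using \<open>tau_bound \<le> c * x\<close> c_ge by simp
  qed
  finally have "c * r (Suc n) \<le> c * (x + 1)" by (simp add: distrib_left)
  then have rx: "r (Suc n) \<le> x + 1" using c by simp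
  have K0: "0 \<le> K"
    by (simp add: K_def progress_const_def)
  define d1 where "d1 = norm (v 1 - v 0)"
  have "(r (Suc n))\<^sup>2 * norm (v (Suc n) - wstar) \<le> K * norm (v (Suc n) - v n)"
    using epoch_progress[OF tau_ge_1, of n "v n"] by (simp add: r_def K_def v_Suc)
  then have "norm (v (Suc n) - wstar) \<le> K * (norm (v (Suc n) - v n) / (r (Suc n))\<^sup>2)"
    using r[of "Suc n"] by (simp add: pos_le_divide_eq mult.commute)
  also have "norm (v (Suc n) - v n) / (r (Suc n))\<^sup>2 \<le> \<beta> ^ n * (d1 / (r 1)\<^sup>2)"
  proof -
    have "c\<^sup>2 * (norm (v (Suc n) - v n) / (real (\<tau> (Suc n)) + 1)\<^sup>2)
        \<le> c\<^sup>2 * (\<beta> ^ n * (d1 / (real (\<tau> 1) + 1)\<^sup>2))"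
      unfolding d1_def by (intro mult_left_mono displacement_decay) auto
    then show ?thesis by (simp add: r_def power_divide mult_ac)
  qed
  also have "d1 \<le> norm (v 0 - wstar) * (1 + 1 / r 1)"
    using epoch_distance[OF tau_ge_1[of 0], of "v 0"] v_Suc[of 0] by (simp add: d1_def r_def)
  finally have "norm (v (Suc n) - wstar)
      \<le> K * (\<beta> ^ n * (norm (v 0 - wstar) * (1 + 1 / r 1) / (r 1)\<^sup>2))"
    using K0 beta by (simp add: mult_left_mono divide_right_mono)
  also have "\<dots> = \<beta> ^ n * (K * (r 1 + 1) / (r 1) ^ 3) * norm (v 0 - wstar)"
    using r[of 1] by (simp add: field_simps power2_eq_square power3_eq_cube)
  also have "K * (r 1 + 1) / (r 1) ^ 3 \<le> 2 * \<beta> * R ^ 3"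
    using final_constant[OF qx r r1x rx] r[of 1]
    by (simp add: K_def x_def pos_divide_le_eq power_mult_distrib mult_ac)
  finally show ?thesis using beta by (simp add: mult_left_mono mult_right_mono mult_ac)
qed

end

theorem theorem3:
  fixes a b :: "real ^ 'n \<Rightarrow> real"
    and \<alpha> L \<beta> \<epsilon> \<eta> l0 kappa \<rho> tstar :: real
    and v0 wstar :: "real ^ 'n"
    and v :: "nat \<Rightarrow> real ^ 'n"
    and \<tau> :: "nat \<Rightarrow> nat"
    and n :: nat
  assumes "\<alpha> > 0"
    and "strongly_convex \<alpha> a"
    and "L_smooth L a"
    and "continuous_on UNIV b"
    and "convex_on UNIV b"
    and "is_arg_min (\<lambda>x. a x + b x) (\<lambda>_. True) wstar"
    and "0 < \<beta>" "\<beta> < 1"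
    and "0 < \<epsilon>" "\<epsilon> < 1"
    and "\<eta> > 1"
    and "0 < l0" "l0 \<le> L"
    and "kappa = L * \<eta> / \<alpha>"
    and "\<rho> = (1 + \<beta>) / \<beta>"
    and "tstar = 1 + sqrt kappa * (\<rho> + sqrt (\<rho>\<^sup>2 + 4 * \<rho>))"
    and "adaptively_restarted_agd a b \<eta> l0 \<beta> v0 v \<tau>"
    and "n = nat \<lceil>log (1 / \<beta>) (2 / \<epsilon>) + 3 * log (1 / \<beta>) (max 1 (tstar / real (\<tau> 1)))\<rceil>"
  shows "norm (wstar - v n) \<le> \<epsilon> * norm (wstar - v0) \<and>
    (\<Sum>i=1..n. real (\<tau> i)) \<le> tstar * real n + 2 * max (real (\<tau> 1) - tstar) 0"
proof -
  \<comment> \<open>The positive root of \<open>q\<^sup>2 = \<rho> * (q + 1)\<close>; with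
    \<open>c\<close> as below, \<open>tstar = 1 + c * q\<close>.\<close>
  define q where "q = (\<rho> + sqrt (\<rho>\<^sup>2 + 4 * \<rho>)) / 2"
  define c where "c = 2 * sqrt kappa"
  have \<rho>: "\<rho> > 0" using assms by simp
  have "q\<^sup>2 = \<rho> * (q + 1)" using \<rho> by (simp add: q_def power2_eq_square field_simps)
  then have q_eq: "\<beta> * q\<^sup>2 = (1 + \<beta>) * (q + 1)" using assms by simp
  have "\<alpha> \<le> L" using assms by (intro strong_convexity_le_smoothness)
  also have "L * 1 \<le> L * \<eta>" using assms by (intro mult_left_mono) auto
  finally have kappa: "kappa \<ge> 1" using assms by simp
  interpret composite_problem a b \<alpha> L \<eta> l0 wstar
    using assms by unfold_locales (auto simp: is_arg_min_linorder)
  have v0: "v 0 = v0" using assms by (simp add: adaptively_restarted_agd_def)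
  interpret restarted_agd a b \<alpha> L \<eta> l0 wstar \<beta> q c v \<tau>
  proof unfold_locales
    show "0 < \<beta>" "\<beta> < 1" by fact+
    show "0 < q" unfolding q_def using \<rho> by (simp add: add_pos_nonneg)
    show "2 \<le> c" unfolding c_def using kappa by simp
    show "\<beta> * q\<^sup>2 = (1 + \<beta>) * (q + 1)" by (rule q_eq)
    show "sigma * c\<^sup>2 = 4"
      using assms kappa by (simp add: sigma_def c_def power_mult_distrib)
    show "adaptively_restarted_agd a b \<eta> l0 \<beta> (v 0) v \<tau>" using assms v0 by simp
  qed
  have tstar: "1 + c * q = tstar" using assms by (simp add: c_def q_def)
  define R where "R = max 1 (tstar / real (\<tau> 1))"
  have R: "R \<ge> 1" by (simp add: R_def)
  have B: "1 / \<beta> > 1" using assms by simp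
  have "log (1 / \<beta>) (2 / \<epsilon> * R ^ 3) = log (1 / \<beta>) (2 / \<epsilon>) + log (1 / \<beta>) (R ^ 3)"
    using \<open>0 < \<epsilon>\<close> R by (intro log_mult_pos) auto
  also have "log (1 / \<beta>) (R ^ 3) = 3 * log (1 / \<beta>) R" using R by (simp add: log_nat_power)
  also have "log (1 / \<beta>) (2 / \<epsilon>) + 3 * log (1 / \<beta>) R \<le> real n" using assms unfolding R_def by linarith
  finally have log_le: "log (1 / \<beta>) (2 / \<epsilon> * R ^ 3) \<le> real n" .
  \<comment> \<open>The logarithm is positive, so \<open>n\<close> is a successor, the form in which
    \<open>distance_le\<close> applies.\<close>
  have "1 * 1 < 2 / \<epsilon> * R ^ 3"
    using assms R by (intro mult_less_le_imp_less) (auto simp: one_le_power)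
  then have "0 < log (1 / \<beta>) (2 / \<epsilon> * R ^ 3)" using B by simp
  then obtain m where n: "n = Suc m" using log_le by (cases n) auto
  have "2 / \<epsilon> * R ^ 3 \<le> (1 / \<beta>) powr real n"
    using log_le B assms R by (subst (asm) log_le_iff) auto
  also have "\<dots> = (1 / \<beta>) ^ n" using assms by (intro powr_realpow) simp
  finally have "2 * \<beta> ^ n * R ^ 3 \<le> \<epsilon>"
    using \<open>0 < \<epsilon>\<close> \<open>0 < \<beta>\<close> by (simp add: field_simps)
  then have "2 * \<beta> ^ n * R ^ 3 * norm (v 0 - wstar) \<le> \<epsilon> * norm (v 0 - wstar)"
    by (intro mult_right_mono) auto
  with distance_le[of m] have "norm (wstar - v n) \<le> \<epsilon> * norm (wstar - v0)"
    by (simp add: n tstar R_def v0 norm_minus_commute)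
  moreover have "(\<Sum>i=1..n. real (\<tau> i)) \<le> tstar * real n + 2 * max (real (\<tau> 1) - tstar) 0"
  proof -
    have "0 \<le> max (real (\<tau> (Suc m)) - tstar) 0" by simp
    then show ?thesis using sum_tau_le[of m] unfolding tstar n by linarith
  qed
  ultimately show ?thesis by blast
qed

end
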